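(* Fix $d\ge 2$. For almost all $d$-permutation hypergraphs $P$ of length $k$, $$\mathrm{ex}_i(P,n)=2^{\Omega(k^{1/2})}n^{d-1}.$$ That is, there is a constant $c=c(d)>0$ such that the proportion of $d$-permutation hypergraphs $P$ of length $k$ (among all of them) satisfying $\mathrm{ex}_i(P,n)\ge 2^{c\,k^{1/2}}n^{d-1}$ for all sufficiently large $n$ tends to $1$ as $k\to\infty$.
   Context: Write $[n]=\{1,\dots,n\}$. A hypergraph here means an ordered hypergraph $H=(V,E)$: $V$ is a linearly ordered set and $E$ is a set of subsets of $V$. The weight of $H$ is $\sum_{e\in E}|e|$. It is $d$-uniform if $|e|=d$ for all $e\in E$. A hypergraph $A=(V_1,E_1)$ contains a hypergraph $B=(V_2,E_2)$ if there are an increasing injection $f:V_2\to V_1$ and an injection $g:E_2\to E_1$ with $f(e)\subseteq g(e)$ for every $e\in E_2$; otherwise $A$ avoids $B$. $\mathrm{ex}_i(H,n)$ is the maximum weight of a hypergraph on vertex set $[n]$ that avoids $H$. A hypergraph is $d$-partite if its ordered vertex set can be partitioned into $d$ consecutive intervals (its parts) such that each edge contains at most one vertex from each part. A $d$-permutation hypergraph of length $k$ is a $d$-uniform, $d$-partite hypergraph $H=([kd],E)$ with parts $\{(i-1)k+1,\dots,ik\}$, $i\in[d]$, of size $k$, such that each vertex $v\in[kd]$ is in exactly one edge. For given $k$ and $d$ there are $(k!)^{d-1}$ of them. *)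

theory Defs
  imports Complex_Main
begin

type_synonym 'a hypergraph = "'a set \<times> 'a set set"

abbreviation verts :: "'a hypergraph \<Rightarrow> 'a set" where
  "verts H \<equiv> fst H"

abbreviation edges :: "'a hypergraph \<Rightarrow> 'a set set" where
  "edges H \<equiv> snd H"

text \<open>The vertex order is the one of the ambient type. The empty edge is allowed.\<close>

definition ordered_hypergraph :: "'a::linorder hypergraph \<Rightarrow> bool" where
  "ordered_hypergraph H \<longleftrightarrow> edges H \<subseteq> Pow (verts H)"

definition weight :: "'a hypergraph \<Rightarrow> nat" where
  "weight H = (\<Sum>e\<in>edges H. card e)"

definition uniform :: "nat \<Rightarrow> 'a hypergraph \<Rightarrow> bool" where
  "uniform d H \<longleftrightarrow> (\<forall>e\<in>edges H. finite e \<and> card e = d)"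

definition contains :: "'a::linorder hypergraph \<Rightarrow> 'b::linorder hypergraph \<Rightarrow> bool" where
  "contains A B \<longleftrightarrow>
     (\<exists>f g. strict_mono_on (verts B) f \<and> f ` verts B \<subseteq> verts A \<and>
            inj_on g (edges B) \<and> g ` edges B \<subseteq> edges A \<and>
            (\<forall>e\<in>edges B. f ` e \<subseteq> g e))"

abbreviation avoids :: "'a::linorder hypergraph \<Rightarrow> 'b::linorder hypergraph \<Rightarrow> bool" where
  "avoids A B \<equiv> \<not> contains A B"

text \<open>The set of weights is finite. It is nonempty whenever \<open>H\<close> has at least one edge,
  because the edgeless hypergraph then avoids \<open>H\<close>; the value of \<open>Max\<close> on the empty set
  plays no role for permutation hypergraphs of positive length.\<close>

definition ex_i :: "'a::linorder hypergraph \<Rightarrow> nat \<Rightarrow> nat" where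
  "ex_i H n = Max {weight A | A :: nat hypergraph.
     ordered_hypergraph A \<and> verts A = {1..n} \<and> avoids A H}"

text \<open>\<open>I 1, \<dots>, I d\<close> are consecutive intervals of the vertex set; the second conjunct makes
  them pairwise disjoint and, together with the first, convex in \<open>verts H\<close>.\<close>

definition partite_with :: "nat \<Rightarrow> (nat \<Rightarrow> 'a set) \<Rightarrow> 'a::linorder hypergraph \<Rightarrow> bool" where
  "partite_with d I H \<longleftrightarrow>
     (\<Union>i\<in>{1..d}. I i) = verts H \<and>
     (\<forall>i\<in>{1..d}. \<forall>j\<in>{1..d}. i < j \<longrightarrow> (\<forall>x\<in>I i. \<forall>y\<in>I j. x < y)) \<and>
     (\<forall>e\<in>edges H. \<forall>i\<in>{1..d}. \<forall>x\<in>e \<inter> I i. \<forall>y\<in>e \<inter> I i. x = y)"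

definition permutation_hypergraph :: "nat \<Rightarrow> nat \<Rightarrow> nat hypergraph \<Rightarrow> bool" where
  "permutation_hypergraph d k H \<longleftrightarrow>
     ordered_hypergraph H \<and> verts H = {1..k * d} \<and> uniform d H \<and>
     partite_with d (\<lambda>i. {(i - 1) * k + 1..i * k}) H \<and>
     (\<forall>v\<in>{1..k * d}. \<exists>!e. e \<in> edges H \<and> v \<in> e)"

end

theory Submission
  imports Defs "HOL-Combinatorics.Permutations"
begin

text \<open>
  Projecting to the first two coordinates turns a \<open>d\<close>-permutation hypergraph \<open>P\<close> into a permutation
  \<open>\<pi>\<close> of \<open>k\<close> points, uniformly distributed when \<open>P\<close> is, and a 0-1 matrix avoiding \<open>\<pi>\<close> yields a
  hypergraph avoiding \<open>P\<close> whose edges extend the matrix entries by arbitrary \<open>(d - 2)\<close>-sets of later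
  vertices. So it suffices to find, for almost all \<open>\<pi>\<close>, a matrix of side \<open>N = 2 ^ r\<close> with
  \<open>r = \<Theta>(sqrt k)\<close> that avoids \<open>\<pi>\<close> and has \<open>N powr (3/2)\<close> ones. As \<open>\<pi>\<close> is sum- or
  skew-indecomposable, copies of it along the diagonal or the antidiagonal serve all larger sizes.

  Following Fox, delete each dyadic rectangle independently with probability of order \<open>1 / r\<close>; an entry
  lies in \<open>(r + 1)\<^sup>2\<close> of them. Cut \<open>\<pi>\<close> into an \<open>l \<times> l\<close> grid with \<open>l = \<Theta>(sqrt k)\<close>; for almost
  all \<open>\<pi>\<close> every row and every column of the grid has a positive proportion of nonempty cells. If
  \<open>\<pi>\<close> occurs, its row groups span \<open>l\<close> disjoint intervals whose smallest enclosing dyadic intervals are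
  distinct; let \<open>T\<close> be the tree of all dyadic intervals containing one of them, and \<open>T'\<close> the same for
  columns. A proportion of the rectangles in \<open>T \<times> T'\<close>, at least of order \<open>l (|T| + |T'|)\<close>, must then
  be undeleted, which beats the exponentially many (in \<open>|T| + |T'|\<close>) choices of the trees.
\<close>

section \<open>Dyadic intervals\<close>

text \<open>The pair \<open>(s, j)\<close> stands for the dyadic interval \<open>{x. x div 2 ^ s = j}\<close>.\<close>

type_synonym node = "nat \<times> nat"

text \<open>Sets of dyadic intervals inside \<open>(s, j)\<close> that are closed under taking
  parents up to the root \<open>(s, j)\<close>. The halves of \<open>(Suc s, j)\<close> are
  \<open>(s, 2 * j)\<close> and \<open>(s, 2 * j + 1)\<close>.\<close>

fun subtrees :: "nat \<Rightarrow> nat \<Rightarrow> node set set" where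
  "subtrees 0 j = {{}, {(0, j)}}"
| "subtrees (Suc s) j = insert {}
     ((\<lambda>(A, B). insert (Suc s, j) (A \<union> B)) ` (subtrees s (2 * j) \<times> subtrees s (2 * j + 1)))"

lemma finite_subtrees: "finite (subtrees s j)"
  by (induction s arbitrary: j) auto

lemma div_power_Suc_diff:
  fixes i :: nat
  shows "u \<le> s \<Longrightarrow> i div 2 ^ (Suc s - u) = i div 2 ^ (s - u) div 2"
  by (simp add: Suc_diff_le div_mult2_eq[symmetric] mult.commute)

lemma div_power_diff:
  fixes x :: nat
  shows "s \<le> u \<Longrightarrow> x div 2 ^ u = x div 2 ^ s div 2 ^ (u - s)"
  by (metis div_mult2_eq le_add_diff_inverse power_add)

text \<open>Locating all nodes inside the root interval makes left and right subtrees disjoint, so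
  that their sizes add up in \<open>sum_subtrees\<close>.\<close>

lemma subtrees_below:
  "T \<in> subtrees s j \<Longrightarrow> finite T \<and> (\<forall>(u, i)\<in>T. u \<le> s \<and> i div 2 ^ (s - u) = j)"
proof (induction s arbitrary: j T)
  case 0
  then show ?case by auto
next
  case (Suc s)
  have lift: "u \<le> Suc s \<and> i div 2 ^ (Suc s - u) = j"
    if "u \<le> s" "i div 2 ^ (s - u) = j'" "j' div 2 = j" for u i j'
    using that div_power_Suc_diff[of u s i] by simp
  show ?case
  proof (cases "T = {}")
    case False
    with Suc.prems obtain A B where AB: "A \<in> subtrees s (2 * j)" "B \<in> subtrees s (2 * j + 1)"
      "T = insert (Suc s, j) (A \<union> B)" by auto
    have fin: "finite T" using Suc.IH[OF AB(1)] Suc.IH[OF AB(2)] AB(3) by simp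
    have "u \<le> Suc s \<and> i div 2 ^ (Suc s - u) = j" if "(u, i) \<in> T" for u i
    proof -
      from that AB(3) consider "(u, i) = (Suc s, j)" | "(u, i) \<in> A" | "(u, i) \<in> B" by blast
      then show ?thesis
      proof cases
        case 2
        then show ?thesis using Suc.IH[OF AB(1)] lift[of u i "2 * j"] by fastforce
      next
        case 3
        then show ?thesis using Suc.IH[OF AB(2)] lift[of u i "2 * j + 1"] by fastforce
      qed simp
    qed
    then show ?thesis using fin by blast
  qed simp
qed

text \<open>From one level to the next the generating function passes from \<open>F\<close> to
  \<open>1 + x * F\<^sup>2\<close>. At \<open>x = 1/4\<close> the value 2 is a fixed point, so the
  bound persists at every depth; union bounds over trees thus do not depend on the depth.\<close>

lemma sum_subtrees: "(\<Sum>T\<in>subtrees s j. (1/4) ^ card T) \<le> (2::real)"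
proof (induction s arbitrary: j)
  case 0
  then show ?case by simp
next
  case (Suc s)
  let ?L = "subtrees s (2 * j)" and ?R = "subtrees s (2 * j + 1)"
  let ?f = "\<lambda>(A, B). insert (Suc s, j) (A \<union> B)"
  have card: "card (?f p) = Suc (card (fst p) + card (snd p))" if p: "p \<in> ?L \<times> ?R" for p
  proof -
    obtain A B where [simp]: "p = (A, B)" by (cases p)
    have A: "finite A \<and> (\<forall>(u, i)\<in>A. u \<le> s \<and> i div 2 ^ (s - u) = 2 * j)"
      and B: "finite B \<and> (\<forall>(u, i)\<in>B. u \<le> s \<and> i div 2 ^ (s - u) = 2 * j + 1)"
      using subtrees_below[of A s "2 * j"] subtrees_below[of B s "2 * j + 1"] p by simp_all
    have "A \<inter> B = {}"
    proof (rule equals0I)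
      fix v assume "v \<in> A \<inter> B"
      then have "2 * j = 2 * j + 1" using A B by (cases v) fastforce
      then show False by simp
    qed
    moreover have "(Suc s, j) \<notin> A \<union> B" using A B by fastforce
    ultimately show ?thesis using A B by (simp add: card_Un_disjoint)
  qed
  have "{} \<notin> ?f ` (?L \<times> ?R)" by auto
  then have "(\<Sum>T\<in>subtrees (Suc s) j. (1/4) ^ card T)
      = 1 + (\<Sum>T\<in>?f ` (?L \<times> ?R). (1/4::real) ^ card T)"
    using finite_subtrees by (simp only: subtrees.simps) (subst sum.insert, simp_all)
  also have "(\<Sum>T\<in>?f ` (?L \<times> ?R). (1/4::real) ^ card T) \<le> (\<Sum>p\<in>?L \<times> ?R. (1/4) ^ card (?f p))"
    using sum_image_le[of "?L \<times> ?R" "\<lambda>T. (1/4::real) ^ card T" ?f] finite_subtrees by (simp add: comp_def)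
  also have "\<dots> = (\<Sum>p\<in>?L \<times> ?R. 1/4 * ((1/4) ^ card (fst p) * (1/4) ^ card (snd p)))"
    by (rule sum.cong[OF refl]) (subst card, simp_all add: power_add)
  also have "\<dots> = 1/4 * ((\<Sum>A\<in>?L. (1/4) ^ card A) * (\<Sum>B\<in>?R. (1/4) ^ card B))"
    by (simp only: sum_product sum.cartesian_product case_prod_unfold flip: sum_distrib_left[of "1/4"])
  also have "\<dots> \<le> 1/4 * (2 * 2)"
    by (intro mult_left_mono mult_mono Suc.IH sum_nonneg) auto
  finally show ?case by simp
qed

text \<open>A pair \<open>(x, y)\<close> in \<open>X\<close> stands for the segment from
  \<open>x\<close> to \<open>y\<close>, which a dyadic interval contains as soon as it contains both
  ends.\<close>

definition cover :: "nat \<Rightarrow> nat \<Rightarrow> node set \<Rightarrow> node set" where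
  "cover s j X = {(u, i). u \<le> s \<and> i div 2 ^ (s - u) = j \<and>
     (\<exists>(x, y)\<in>X. x div 2 ^ u = i \<and> y div 2 ^ u = i)}"

text \<open>Containing a segment passes from a dyadic interval to its parent. So if the root
  contains no segment, nothing is covered; otherwise the cover is the root together with the covers
  in its two halves.\<close>

lemma cover_in_subtrees: "cover s j X \<in> subtrees s j"
proof (induction s arbitrary: j)
  case 0
  have "cover 0 j X \<subseteq> {(0, j)}" by (auto simp: cover_def)
  then show ?case by (auto simp: subset_singleton_iff)
next
  case (Suc s)
  show ?case
  proof (cases "\<exists>(x, y)\<in>X. x div 2 ^ Suc s = j \<and> y div 2 ^ Suc s = j")
    case False
    have "cover (Suc s) j X = {}"
    proof (rule equals0I)
      fix p assume "p \<in> cover (Suc s) j X"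
      then obtain u i x y where "u \<le> Suc s" "i div 2 ^ (Suc s - u) = j" "(x, y) \<in> X"
        "x div 2 ^ u = i" "y div 2 ^ u = i" by (auto simp: cover_def)
      then have "x div 2 ^ Suc s = j" "y div 2 ^ Suc s = j"
        using div_power_diff[of u "Suc s" x] div_power_diff[of u "Suc s" y] by simp_all
      with \<open>(x, y) \<in> X\<close> False show False by blast
    qed
    then show ?thesis by simp
  next
    case root: True
    have "cover (Suc s) j X = insert (Suc s, j) (cover s (2 * j) X \<union> cover s (2 * j + 1) X)"
    proof (intro set_eqI)
      fix p :: node obtain u i where p: "p = (u, i)" by (cases p)
      show "p \<in> cover (Suc s) j X \<longleftrightarrow> p \<in> insert (Suc s, j) (cover s (2 * j) X \<union> cover s (2 * j + 1) X)"
      proof (cases "u \<le> s")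
        case True
        have "i div 2 ^ (s - u) div 2 = j \<longleftrightarrow> i div 2 ^ (s - u) = 2 * j \<or> i div 2 ^ (s - u) = 2 * j + 1"
          by linarith
        then show ?thesis using True div_power_Suc_diff[OF True, of i] by (auto simp: p cover_def)
      next
        case False
        have "p \<in> cover (Suc s) j X \<longleftrightarrow> p = (Suc s, j)"
        proof
          assume "p = (Suc s, j)"
          then show "p \<in> cover (Suc s) j X"
            using root by (simp add: cover_def del: power_Suc)
        qed (use False in \<open>auto simp: p cover_def le_Suc_eq\<close>)
        then show ?thesis using False by (auto simp: p cover_def)
      qed
    qed
    then show ?thesis using Suc.IH[of "2 * j"] Suc.IH[of "2 * j + 1"] by auto
  qed
qed

section \<open>Smallest enclosing dyadic intervals and their left-to-right order\<close>

definition apex :: "nat \<Rightarrow> nat \<Rightarrow> node" where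
  "apex x y = (let s = LEAST s. x div 2 ^ s = y div 2 ^ s in (s, x div 2 ^ s))"

text \<open>Twice the midpoint of the dyadic interval, so that keys list nodes in in-order.\<close>

definition key :: "node \<Rightarrow> nat" where
  "key v = (2 * snd v + 1) * 2 ^ fst v"

lemma apex_cases:
  assumes "x < 2 ^ r" "y < 2 ^ r"
  obtains s where "apex x y = (s, x div 2 ^ s)" "s \<le> r" "y div 2 ^ s = x div 2 ^ s"
    "\<And>u. x div 2 ^ u = y div 2 ^ u \<longleftrightarrow> s \<le> u"
proof -
  define s where "s = (LEAST s. x div 2 ^ s = y div 2 ^ s)"
  have r: "x div 2 ^ r = y div 2 ^ r" using assms by simp
  have s: "x div 2 ^ s = y div 2 ^ s" unfolding s_def by (rule LeastI[of _ r]) (rule r)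
  have "x div 2 ^ u = y div 2 ^ u \<longleftrightarrow> s \<le> u" for u
  proof
    assume "s \<le> u"
    then show "x div 2 ^ u = y div 2 ^ u"
      by (simp only: s div_power_diff[of s u x] div_power_diff[of s u y])
  next
    assume "x div 2 ^ u = y div 2 ^ u"
    then show "s \<le> u" unfolding s_def by (rule Least_le)
  qed
  moreover have "apex x y = (s, x div 2 ^ s)" by (simp only: apex_def Let_def s_def)
  moreover have "s \<le> r" unfolding s_def by (rule Least_le) (rule r)
  ultimately show ?thesis using s[symmetric] by (intro that) blast+
qed

text \<open>If \<open>x < y\<close>, the midpoint of the apex separates \<open>x\<close> from
  \<open>y\<close>, since otherwise one half would contain both. Hence disjoint segments listed from
  left to right have strictly increasing keys, and so distinct apexes. The \<open>+ 1\<close>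
  accommodates one-point segments.\<close>

lemma key_apex:
  assumes "x \<le> y" "y < 2 ^ r"
  shows "2 * x < key (apex x y)" "key (apex x y) \<le> 2 * y + 1"
proof -
  obtain s where s: "apex x y = (s, x div 2 ^ s)" "y div 2 ^ s = x div 2 ^ s"
    "\<And>u. x div 2 ^ u = y div 2 ^ u \<longleftrightarrow> s \<le> u"
    using apex_cases[of x r y] assms by auto
  have "2 * x < key (apex x y) \<and> key (apex x y) \<le> 2 * y + 1"
  proof (cases s)
    case 0
    then show ?thesis using s assms by (simp add: key_def)
  next
    \<comment> \<open>Level \<open>u\<close> is that of the two halves of the apex, where
      \<open>x\<close> and \<open>y\<close> are still apart.\<close>
    case (Suc u)
    define j where "j = x div 2 ^ s"
    have ne: "x div 2 ^ u \<noteq> y div 2 ^ u" using s(3)[of u] Suc by simp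
    have le: "x div 2 ^ u \<le> y div 2 ^ u" using assms(1) by (rule div_le_mono)
    have "x div 2 ^ u div 2 = j" "y div 2 ^ u div 2 = j"
      using s(2) unfolding j_def Suc by (simp_all add: div_mult2_eq[symmetric] mult.commute)
    then have "x div 2 ^ u < 2 * j + 1" "2 * j + 1 \<le> y div 2 ^ u"
      using ne le by linarith+
    then have "x < (2 * j + 1) * 2 ^ u" "(2 * j + 1) * 2 ^ u \<le> y"
      by (simp_all add: div_less_iff_less_mult less_eq_div_iff_mult_less_eq)
    moreover have "key (apex x y) = 2 * ((2 * j + 1) * 2 ^ u)"
      by (simp only: s(1) key_def flip: j_def) (simp add: Suc)
    ultimately show ?thesis by linarith
  qed
  then show "2 * x < key (apex x y)" "key (apex x y) \<le> 2 * y + 1" by auto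
qed

text \<open>A list strictly sorted by \<open>key\<close> can be recovered from its set, which is one
  of the \<open>2 ^ card T\<close> subsets of \<open>T\<close>.\<close>

lemma card_sorted_lists:
  assumes "finite T"
  shows "finite {vs. set vs \<subseteq> T \<and> sorted_wrt (\<lambda>u v. key u < key v) vs}"
    and "card {vs. set vs \<subseteq> T \<and> sorted_wrt (\<lambda>u v. key u < key v) vs} \<le> 2 ^ card T"
proof -
  let ?L = "{vs. set vs \<subseteq> T \<and> sorted_wrt (\<lambda>u v. key u < key v) vs}"
  have key: "sorted (map key vs) \<and> distinct (map key vs)" if "vs \<in> ?L" for vs
    using that strict_sorted_iff[of "map key vs"] by (simp add: sorted_wrt_map)
  have inj: "inj_on set ?L"
  proof (rule inj_onI)
    fix us vs assume H: "us \<in> ?L" "vs \<in> ?L" "set us = set vs"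
    have "map key us = map key vs"
      using key[OF H(1)] key[OF H(2)] H(3) by (intro sorted_distinct_set_unique) auto
    moreover have "inj_on key (set us \<union> set vs)"
      using key[OF H(1)] H(3) by (simp add: distinct_map)
    ultimately show "us = vs" by (rule map_inj_on)
  qed
  have sub: "set ` ?L \<subseteq> Pow T" by auto
  show "finite ?L" using inj sub assms by (meson finite_Pow_iff inj_on_finite)
  show "card ?L \<le> 2 ^ card T" using card_inj_on_le[OF inj sub] assms by (simp add: card_Pow)
qed

section \<open>Random deletion of dyadic rectangles\<close>

text \<open>The left side is the probability that a random subset of \<open>Q\<close>, containing
  each element independently with probability \<open>q\<close>, misses \<open>U\<close>.\<close>

lemma sum_random_subset:
  fixes q :: real
  assumes "finite Q" "U \<subseteq> Q"
  shows "(\<Sum>K | K \<subseteq> Q \<and> K \<inter> U = {}. q ^ card K * (1 - q) ^ card (Q - K)) = (1 - q) ^ card U"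
proof -
  \<comment> \<open>Weight 0 on \<open>U\<close> removes exactly the sets meeting \<open>U\<close>
    from the expansion of a product over \<open>Q\<close>.\<close>
  let ?f = "\<lambda>x. if x \<in> U then 0 else q"
  have fin: "finite K" if "K \<subseteq> Q" for K using that assms(1) by (rule finite_subset)
  have "(\<Sum>K | K \<subseteq> Q \<and> K \<inter> U = {}. q ^ card K * (1 - q) ^ card (Q - K))
      = (\<Sum>K\<in>Pow Q. (\<Prod>x\<in>K. ?f x) * (\<Prod>x\<in>Q - K. 1 - q))"
  proof (rule sum.mono_neutral_cong_left)
    show "\<forall>K\<in>Pow Q - {K. K \<subseteq> Q \<and> K \<inter> U = {}}. (\<Prod>x\<in>K. ?f x) * (\<Prod>x\<in>Q - K. 1 - q) = 0"
      by (auto simp: fin intro!: prod_zero)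
    fix K assume "K \<in> {K. K \<subseteq> Q \<and> K \<inter> U = {}}"
    then have "(\<Prod>x\<in>K. ?f x) = (\<Prod>x\<in>K. q)" by (intro prod.cong) auto
    then show "q ^ card K * (1 - q) ^ card (Q - K) = (\<Prod>x\<in>K. ?f x) * (\<Prod>x\<in>Q - K. 1 - q)"
      by simp
  qed (use assms in auto)
  also have "\<dots> = (\<Prod>x\<in>Q. ?f x + (1 - q))"
    using assms(1) by (rule prod_add[symmetric])
  also have "\<dots> = (\<Prod>x\<in>Q. if x \<in> U then 1 - q else 1)"
    by (intro prod.cong) auto
  also have "\<dots> = (1 - q) ^ card U"
    using assms by (simp add: prod.If_cases Int_absorb1)
  finally show ?thesis .
qed

text \<open>As dyadic intervals, \<open>D\<close> contains \<open>V\<close>; equality is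
  allowed.\<close>

definition above :: "node \<Rightarrow> node \<Rightarrow> bool" where
  "above D V \<longleftrightarrow> fst V \<le> fst D \<and> snd V div 2 ^ (fst D - fst V) = snd D"

text \<open>A tree \<open>T\<close> generated by \<open>l\<close> marked nodes. These will be the apexes of the intervals; the sorting
  makes the list of marks determined by its set, so that \<open>T\<close> has at most \<open>2 ^ card T\<close> of them.\<close>

definition configs :: "nat \<Rightarrow> nat \<Rightarrow> (node set \<times> node list) set" where
  "configs r l = {(T, vs). T \<in> subtrees r 0 \<and> length vs = l \<and> set vs \<subseteq> T \<and>
     sorted_wrt (\<lambda>u v. key u < key v) vs \<and> (\<forall>D\<in>T. \<exists>V\<in>set vs. above D V)}"

lemma above_refl: "above V V"
  by (simp add: above_def)

lemma sorted_key_distinct: "sorted_wrt (\<lambda>u v. key u < key v) vs \<Longrightarrow> distinct vs"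
  by (induction vs) auto

lemma config_card_ge:
  assumes "(T, vs) \<in> configs r l"
  shows "l \<le> card T" "finite T"
proof -
  show fin: "finite T" using assms subtrees_below by (auto simp: configs_def)
  have "l = card (set vs)"
    using assms by (auto simp: configs_def dest!: sorted_key_distinct distinct_card)
  then show "l \<le> card T" using assms fin by (auto simp: configs_def intro: card_mono)
qed

lemma finite_configs: "finite (configs r l)"
proof -
  have "configs r l \<subseteq> (SIGMA T:subtrees r 0. {vs. set vs \<subseteq> T \<and> sorted_wrt (\<lambda>u v. key u < key v) vs})"
    by (auto simp: configs_def)
  then show ?thesis
    by (rule finite_subset) (use subtrees_below card_sorted_lists in \<open>auto intro!: finite_subtrees\<close>)
qed

text \<open>Split \<open>1/16\<close> into \<open>1/2 * 1/8\<close>. The first factor yields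
  \<open>(1/2) ^ l\<close>, as a tree has at least \<open>l\<close> nodes; the at most
  \<open>2 ^ card T\<close> lists of marks turn the second into the \<open>1/4\<close> of
  \<open>sum_subtrees\<close>.\<close>

lemma sum_configs: "(\<Sum>c\<in>configs r l. (1/16) ^ card (fst c)) \<le> 2 * (1/2::real) ^ l"
proof -
  let ?S = "\<lambda>T. {vs. set vs \<subseteq> T \<and> sorted_wrt (\<lambda>u v. key u < key v) vs}"
  have fin: "finite T" if "T \<in> subtrees r 0" for T using that subtrees_below by blast
  have "(\<Sum>c\<in>configs r l. (1/16) ^ card (fst c)) \<le> (\<Sum>c\<in>configs r l. (1/2) ^ l * (1/8::real) ^ card (fst c))"
  proof (rule sum_mono)
    fix c assume "c \<in> configs r l"
    then have "l \<le> card (fst c)" using config_card_ge(1)[of "fst c" "snd c"] by simp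
    then have "(1/2) ^ card (fst c) \<le> (1/2::real) ^ l" by (intro power_decreasing) auto
    then have "(1/2) ^ card (fst c) * (1/8) ^ card (fst c) \<le> (1/2::real) ^ l * (1/8) ^ card (fst c)"
      by (intro mult_right_mono) auto
    then show "(1/16) ^ card (fst c) \<le> (1/2::real) ^ l * (1/8) ^ card (fst c)"
      by (simp flip: power_mult_distrib)
  qed
  also have "\<dots> = (1/2) ^ l * (\<Sum>c\<in>configs r l. (1/8::real) ^ card (fst c))"
    by (simp add: sum_distrib_left)
  also have "(\<Sum>c\<in>configs r l. (1/8::real) ^ card (fst c)) \<le> (\<Sum>c\<in>(SIGMA T:subtrees r 0. ?S T). (1/8) ^ card (fst c))"
    by (intro sum_mono2 finite_SigmaI finite_subtrees card_sorted_lists(1) fin)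
      (auto simp: configs_def)
  also have "\<dots> = (\<Sum>T\<in>subtrees r 0. real (card (?S T)) * (1/8) ^ card T)"
  proof -
    have "(\<Sum>c\<in>(SIGMA T:subtrees r 0. ?S T). (1/8::real) ^ card (fst c))
        = (\<Sum>T\<in>subtrees r 0. \<Sum>vs\<in>?S T. (1/8) ^ card T)"
      using sum.Sigma[OF finite_subtrees, of r 0 ?S "\<lambda>T vs. (1/8::real) ^ card T"]
        fin[THEN card_sorted_lists(1)] by (simp add: case_prod_unfold)
    then show ?thesis by simp
  qed
  also have "\<dots> \<le> (\<Sum>T\<in>subtrees r 0. (1/4) ^ card T)"
  proof (rule sum_mono)
    fix T assume "T \<in> subtrees r 0"
    then have "real (card (?S T)) \<le> 2 ^ card T"
      using of_nat_mono[OF card_sorted_lists(2)[OF fin], of T, where ?'a = real] by simp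
    then have "real (card (?S T)) * (1/8) ^ card T \<le> 2 ^ card T * (1/8) ^ card T"
      by (intro mult_right_mono) auto
    then show "real (card (?S T)) * (1/8) ^ card T \<le> (1/4) ^ card T"
      by (simp flip: power_mult_distrib)
  qed
  also have "\<dots> \<le> 2" by (rule sum_subtrees)
  finally show ?thesis by (simp add: mult.commute)
qed

text \<open>The dyadic rectangles that must survive if all cells in \<open>G\<close> are to be nonempty.\<close>

definition forced :: "(nat \<times> nat) set \<Rightarrow> node set \<times> node list \<Rightarrow> node set \<times> node list \<Rightarrow> (node \<times> node) set" where
  "forced G c c' = {(D, E). D \<in> fst c \<and> E \<in> fst c' \<and>
     (\<exists>(a, b)\<in>G. a < length (snd c) \<and> b < length (snd c') \<and> above D (snd c ! a) \<and> above E (snd c' ! b))}"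

lemma forced_converse: "forced (G\<inverse>) c' c = (forced G c c')\<inverse>"
  unfolding forced_def by fast

text \<open>Every \<open>D\<close> in the first tree lies above some mark, say the one with index
  \<open>a\<close>. Each cell \<open>(a, b)\<close> of \<open>G\<close> then forces the product of
  \<open>D\<close> and mark \<open>b\<close> of the second tree. These marks are distinct, so each
  \<open>D\<close> contributes at least \<open>\<delta>\<close> rectangles.\<close>

lemma card_forced_ge:
  assumes c: "c \<in> configs r l" and c': "c' \<in> configs r l"
    and deg: "\<And>a. a < l \<Longrightarrow> \<delta> \<le> card {b. b < l \<and> (a, b) \<in> G}"
  shows "\<delta> * card (fst c) \<le> card (forced G c c')"
proof -
  obtain T vs T' vs' where [simp]: "c = (T, vs)" "c' = (T', vs')" by (cases c, cases c') auto
  have fin: "finite T" "finite T'" using config_card_ge(2) c c' by auto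
  have dist: "distinct vs'" using c' sorted_key_distinct by (auto simp: configs_def)
  have len: "length vs = l" "length vs' = l" using c c' by (auto simp: configs_def)
  have row: "\<delta> \<le> card {E. (D, E) \<in> forced G c c'}" if "D \<in> T" for D
  proof -
    obtain a where a: "a < l" "above D (vs ! a)"
    proof -
      obtain V where "V \<in> set vs" "above D V" using c \<open>D \<in> T\<close> by (auto simp: configs_def)
      then show ?thesis using that len(1) by (metis in_set_conv_nth)
    qed
    have "card {b. b < l \<and> (a, b) \<in> G} = card ((!) vs' ` {b. b < l \<and> (a, b) \<in> G})"
      by (rule card_image[symmetric]) (use dist len in \<open>auto simp: inj_on_def nth_eq_iff_index_eq\<close>)
    also have "\<dots> \<le> card {E. (D, E) \<in> forced G c c'}"
    proof (rule card_mono)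
      show "finite {E. (D, E) \<in> forced G c c'}"
        by (rule finite_subset[OF _ fin(2)]) (auto simp: forced_def)
      show "(!) vs' ` {b. b < l \<and> (a, b) \<in> G} \<subseteq> {E. (D, E) \<in> forced G c c'}"
      proof (rule image_subsetI, rule CollectI)
        fix b assume b: "b \<in> {b. b < l \<and> (a, b) \<in> G}"
        then have "vs' ! b \<in> set vs'" using len by simp
        then have "vs' ! b \<in> T'" using c' by (auto simp: configs_def)
        then show "(D, vs' ! b) \<in> forced G c c'"
          using a b that len above_refl[of "vs' ! b"] unfolding forced_def by force
      qed
    qed
    finally show ?thesis using deg[OF a(1)] by simp
  qed
  have "\<delta> * card T = (\<Sum>D\<in>T. \<delta>)" by simp
  also have "\<dots> \<le> (\<Sum>D\<in>T. card {E. (D, E) \<in> forced G c c'})" by (rule sum_mono) (rule row)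
  also have "\<dots> = card (SIGMA D:T. {E. (D, E) \<in> forced G c c'})"
    by (rule card_SigmaI[symmetric])
      (use fin in \<open>auto simp: forced_def intro: finite_subset[OF _ fin(2)]\<close>)
  also have "(SIGMA D:T. {E. (D, E) \<in> forced G c c'}) = forced G c c'"
    by (auto simp: forced_def)
  finally show ?thesis by simp
qed

text \<open>The bound through the second tree is the bound through the first for the transposed
  pattern; adding the two explains the factor 2.\<close>

lemma card_forced_ge_add:
  assumes c: "c \<in> configs r l" and c': "c' \<in> configs r l"
    and deg1: "\<And>a. a < l \<Longrightarrow> \<delta> \<le> card {b. b < l \<and> (a, b) \<in> G}"
    and deg2: "\<And>b. b < l \<Longrightarrow> \<delta> \<le> card {a. a < l \<and> (a, b) \<in> G}"
  shows "\<delta> * (card (fst c) + card (fst c')) \<le> 2 * card (forced G c c')"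
proof -
  have "\<delta> * card (fst c') \<le> card (forced (G\<inverse>) c' c)"
    by (rule card_forced_ge[OF c' c]) (simp add: deg2)
  also have "\<dots> = card (forced G c c')"
    by (simp add: forced_converse card_inverse)
  finally show ?thesis using card_forced_ge[OF c c' deg1] by (simp add: distrib_left)
qed

section \<open>Interval minors and the configurations they generate\<close>

definition separated :: "nat \<Rightarrow> nat \<Rightarrow> (nat \<Rightarrow> nat) \<Rightarrow> (nat \<Rightarrow> nat) \<Rightarrow> bool" where
  "separated l N lo hi \<longleftrightarrow>
     (\<forall>a<l. lo a \<le> hi a \<and> hi a < N) \<and> (\<forall>a b. a < b \<longrightarrow> b < l \<longrightarrow> hi a < lo b)"

text \<open>Contracting intervals of rows and of columns turns \<open>S\<close> into a matrix that
  is nonzero on \<open>G\<close>. Unlike in an occurrence, different cells of one row of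
  \<open>G\<close> may use different rows of \<open>S\<close>.\<close>

definition interval_minor :: "nat \<Rightarrow> (nat \<times> nat) set \<Rightarrow> nat \<Rightarrow> (nat \<times> nat) set \<Rightarrow> bool" where
  "interval_minor l G N S \<longleftrightarrow>
     (\<exists>lo hi lo' hi'. separated l N lo hi \<and> separated l N lo' hi' \<and>
       (\<forall>(a, b)\<in>G. \<exists>(x, y)\<in>S. x \<in> {lo a..hi a} \<and> y \<in> {lo' b..hi' b}))"

text \<open>The marks are sorted because disjoint segments have increasing keys. A dyadic interval
  containing a segment contains its apex, so the apexes generate the whole cover.\<close>

lemma separated_config:
  assumes "separated l (2 ^ r) lo hi"
  shows "(cover r 0 ((\<lambda>a. (lo a, hi a)) ` {..<l}), map (\<lambda>a. apex (lo a) (hi a)) [0..<l]) \<in> configs r l"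
proof -
  let ?T = "cover r 0 ((\<lambda>a. (lo a, hi a)) ` {..<l})"
  let ?v = "\<lambda>a. apex (lo a) (hi a)"
  have le: "lo a \<le> hi a" "hi a < 2 ^ r" "lo a < 2 ^ r" if "a < l" for a
    using assms that unfolding separated_def by (blast intro: le_less_trans)+
  have in_T: "?v a \<in> ?T" if a: "a < l" for a
  proof -
    obtain s where s: "?v a = (s, lo a div 2 ^ s)" "s \<le> r" "hi a div 2 ^ s = lo a div 2 ^ s"
      using apex_cases[OF le(3)[OF a] le(2)[OF a]] by metis
    have "lo a div 2 ^ s div 2 ^ (r - s) = 0"
      using div_power_diff[OF s(2), of "lo a"] le(3)[OF a] by simp
    then show ?thesis using s a by (auto simp: cover_def)
  qed
  have sorted: "sorted_wrt (\<lambda>u v. key u < key v) (map ?v [0..<l])"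
  proof -
    have "key (?v a) < key (?v b)" if "a < b" "b < l" for a b
    proof -
      have "hi a < lo b" using assms that by (auto simp: separated_def)
      then show ?thesis
        using key_apex(2)[OF le(1,2), of a] key_apex(1)[OF le(1,2), of b] that by linarith
    qed
    then show ?thesis by (auto simp: sorted_wrt_map sorted_wrt_iff_nth_less)
  qed
  have above: "\<exists>V\<in>set (map ?v [0..<l]). above D V" if mem: "D \<in> ?T" for D
  proof -
    obtain a where a: "a < l" and D: "lo a div 2 ^ fst D = snd D" "hi a div 2 ^ fst D = snd D"
      using mem by (auto simp: cover_def)
    obtain s where s: "?v a = (s, lo a div 2 ^ s)" "\<And>u. lo a div 2 ^ u = hi a div 2 ^ u \<longleftrightarrow> s \<le> u"
      using apex_cases[OF le(3)[OF a] le(2)[OF a]] by metis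
    have "s \<le> fst D" using s(2)[of "fst D"] D by simp
    then have "above D (?v a)"
      using div_power_diff[of s "fst D" "lo a"] by (simp add: above_def D(1) s(1))
    then show ?thesis using a by auto
  qed
  show ?thesis
    using cover_in_subtrees in_T sorted above by (auto simp: configs_def)
qed

lemma above_apex:
  assumes "above D (apex x y)" "x \<le> z" "z \<le> y" "y < 2 ^ r"
  shows "z div 2 ^ fst D = snd D"
proof -
  obtain s where s: "apex x y = (s, x div 2 ^ s)" "y div 2 ^ s = x div 2 ^ s"
    using apex_cases[of x r y] assms by (metis le_less_trans order_trans)
  have su: "s \<le> fst D" and D: "x div 2 ^ s div 2 ^ (fst D - s) = snd D"
    using assms(1) by (simp_all add: above_def s(1))
  have x: "x div 2 ^ fst D = snd D" and y: "y div 2 ^ fst D = snd D"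
    by (simp_all only: div_power_diff[OF su] D s(2))
  have "x div 2 ^ fst D \<le> z div 2 ^ fst D" "z div 2 ^ fst D \<le> y div 2 ^ fst D"
    using assms by (simp_all add: div_le_mono)
  with x y show ?thesis by linarith
qed

definition nodes :: "nat \<Rightarrow> node set" where
  "nodes r = (SIGMA s:{..r}. {..<2 ^ (r - s)})"

text \<open>The product \<open>path r x \<times> path r y\<close> lists the dyadic rectangles
  through the entry \<open>(x, y)\<close>, which survives if none of them is deleted.\<close>

definition path :: "nat \<Rightarrow> nat \<Rightarrow> node set" where
  "path r x = (\<lambda>s. (s, x div 2 ^ s)) ` {..r}"

lemma finite_nodes: "finite (nodes r)"
  by (auto simp: nodes_def)

lemma config_subset_nodes:
  assumes "c \<in> configs r l"
  shows "fst c \<subseteq> nodes r"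
proof
  fix v assume v: "v \<in> fst c"
  obtain u i where ui: "v = (u, i)" by (cases v)
  have "fst c \<in> subtrees r 0" using assms by (auto simp: configs_def)
  then have "u \<le> r" "i div 2 ^ (r - u) = 0" using subtrees_below v ui by fastforce+
  then show "v \<in> nodes r" by (simp add: ui nodes_def div_eq_0_iff)
qed

lemma path_subset_nodes:
  assumes "x < 2 ^ r"
  shows "path r x \<subseteq> nodes r"
proof -
  have "x div 2 ^ s < 2 ^ (r - s)" if "s \<le> r" for s
    using assms that by (simp add: div_less_iff_less_mult flip: power_add)
  then show ?thesis by (auto simp: path_def nodes_def)
qed

lemma card_path: "card (path r x) = Suc r"
  unfolding path_def by (subst card_image) (auto simp: inj_on_def)

text \<open>The deterministic part. A cell of the minor holds a surviving entry, and every dyadic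
  rectangle containing the two segments of that cell contains this entry, so it is not in
  \<open>K\<close>. The two configurations are those generated by the row segments and by the column
  segments.\<close>

lemma config_minor_hits:
  assumes S: "S \<subseteq> {(x, y). K \<inter> path r x \<times> path r y = {}}"
    and minor: "interval_minor l G (2 ^ r) S"
  shows "\<exists>c\<in>configs r l. \<exists>c'\<in>configs r l. K \<inter> forced G c c' = {}"
proof -
  obtain lo hi lo' hi' where sep: "separated l (2 ^ r) lo hi" "separated l (2 ^ r) lo' hi'"
    and G: "\<And>a b. (a, b) \<in> G \<Longrightarrow> \<exists>(x, y)\<in>S. x \<in> {lo a..hi a} \<and> y \<in> {lo' b..hi' b}"
    using minor unfolding interval_minor_def by blast
  let ?c = "\<lambda>lo hi. (cover r 0 ((\<lambda>a. (lo a, hi a)) ` {..<l}), map (\<lambda>a. apex (lo a) (hi a)) [0..<l])"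
  have mem: "?c lo hi \<in> configs r l" "?c lo' hi' \<in> configs r l"
    using sep by (simp_all add: separated_config)
  have "K \<inter> forced G (?c lo hi) (?c lo' hi') = {}"
  proof (rule equals0I)
    fix p assume p: "p \<in> K \<inter> forced G (?c lo hi) (?c lo' hi')"
    obtain D E where DE: "p = (D, E)" by (cases p)
    with p obtain a b where ab: "(a, b) \<in> G" "a < l" "b < l"
      "above D (apex (lo a) (hi a))" "above E (apex (lo' b) (hi' b))"
      "D \<in> fst (?c lo hi)" "E \<in> fst (?c lo' hi')"
      by (auto simp: forced_def)
    obtain x y where xy: "(x, y) \<in> S" "x \<in> {lo a..hi a}" "y \<in> {lo' b..hi' b}"
      using G[OF ab(1)] by blast
    have "hi a < 2 ^ r" "hi' b < 2 ^ r" using sep ab by (auto simp: separated_def)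
    then have "x div 2 ^ fst D = snd D" "y div 2 ^ fst E = snd E"
      using above_apex ab xy by (metis atLeastAtMost_iff)+
    moreover have "fst D \<le> r" "fst E \<le> r"
      using config_subset_nodes[OF mem(1)] config_subset_nodes[OF mem(2)] ab(6,7)
      by (auto simp: nodes_def)
    ultimately have "D \<in> path r x" "E \<in> path r y"
      unfolding path_def by (auto intro!: image_eqI[of D _ "fst D"] image_eqI[of E _ "fst E"] simp: prod_eq_iff)
    then show False using S xy(1) p DE by auto
  qed
  with mem show ?thesis by blast
qed

section \<open>Union bound and expectation over random deletions\<close>

lemma sum_UN_le:
  fixes w :: "'b \<Rightarrow> real"
  assumes "finite I" "\<And>i. i \<in> I \<Longrightarrow> finite (A i)" "\<And>x. 0 \<le> w x"
  shows "sum w (\<Union>i\<in>I. A i) \<le> (\<Sum>i\<in>I. sum w (A i))"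
proof -
  have "(\<Union>i\<in>I. A i) = snd ` Sigma I A" by force
  then have "sum w (\<Union>i\<in>I. A i) \<le> (\<Sum>p\<in>Sigma I A. w (snd p))"
    using sum_image_le[of "Sigma I A" w snd] assms by (simp add: comp_def)
  also have "\<dots> = (\<Sum>i\<in>I. sum w (A i))"
    using sum.Sigma[of I A "\<lambda>_. w"] assms by (simp add: case_prod_unfold)
  finally show ?thesis .
qed

text \<open>At least \<open>1024 * t\<close> rectangles are forced per node of the two trees. As
  \<open>(1 - q) ^ (1024 * t) \<le> exp (- 8) \<le> 1/16\<close>, all forced rectangles survive with
  probability at most the product of the two weights from \<open>sum_configs\<close>, and the double
  sum factors.\<close>

lemma random_kill_failure_le:
  fixes q :: real
  assumes q: "q = 1 / (128 * real t)" and t: "t \<ge> 1"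
    and deg1: "\<And>a. a < l \<Longrightarrow> 2048 * t \<le> card {b. b < l \<and> (a, b) \<in> G}"
    and deg2: "\<And>b. b < l \<Longrightarrow> 2048 * t \<le> card {a. a < l \<and> (a, b) \<in> G}"
  shows "(\<Sum>c\<in>configs r l. \<Sum>c'\<in>configs r l. (1 - q) ^ card (forced G c c')) \<le> 4 * (1/4) ^ l"
proof -
  have q01: "0 \<le> 1 - q" "1 - q \<le> 1" using t by (simp_all add: q divide_simps)
  have "1 - q \<le> exp (- q)" using exp_ge_add_one_self[of "- q"] by simp
  then have "(1 - q) ^ (1024 * t) \<le> exp (- q) ^ (1024 * t)" using q01 by (intro power_mono)
  also have "\<dots> = exp (- 8)" using t by (simp add: q flip: exp_of_nat_mult)
  also have "\<dots> \<le> 1 / 16"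
  proof -
    have "(2::real) ^ 8 \<le> exp 1 ^ 8" using exp_ge_add_one_self[of 1] by (intro power_mono) auto
    then have "16 \<le> exp (8::real)" by (simp flip: exp_of_nat_mult)
    then show ?thesis by (simp add: exp_minus divide_simps)
  qed
  finally have base: "(1 - q) ^ (1024 * t) \<le> 1 / 16" .
  have "(1 - q) ^ card (forced G c c') \<le> (1/16) ^ card (fst c) * (1/16) ^ card (fst c')"
    if "c \<in> configs r l" "c' \<in> configs r l" for c c'
  proof -
    have "1024 * t * (card (fst c) + card (fst c')) \<le> card (forced G c c')"
      using card_forced_ge_add[OF that deg1 deg2] by simp
    then have "(1 - q) ^ card (forced G c c') \<le> (1 - q) ^ (1024 * t * (card (fst c) + card (fst c')))"
      using q01 by (intro power_decreasing)
    also have "\<dots> \<le> (1/16) ^ (card (fst c) + card (fst c'))"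
      unfolding power_mult[of "1 - q" "1024 * t"] using base q01 by (intro power_mono) simp_all
    finally show ?thesis by (simp add: power_add)
  qed
  then have "(\<Sum>c\<in>configs r l. \<Sum>c'\<in>configs r l. (1 - q) ^ card (forced G c c'))
      \<le> (\<Sum>c\<in>configs r l. \<Sum>c'\<in>configs r l. (1/16) ^ card (fst c) * (1/16) ^ card (fst c'))"
    by (intro sum_mono)
  also have "\<dots> = (\<Sum>c\<in>configs r l. (1/16) ^ card (fst c)) * (\<Sum>c\<in>configs r l. (1/16) ^ card (fst c))"
    by (simp add: sum_product)
  also have "\<dots> \<le> (2 * (1/2) ^ l) * (2 * (1/2) ^ l)"
    by (intro mult_mono sum_configs sum_nonneg) auto
  also have "\<dots> = 4 * (1/4) ^ l" by (simp flip: power_mult_distrib)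
  finally show ?thesis .
qed

text \<open>For \<open>r = 4 * t\<close> an entry lies in
  \<open>(4 * t + 1)\<^sup>2 \<le> 64 * t\<^sup>2\<close> rectangles. By Bernoulli's inequality, any
  \<open>64 * t\<close> of them all survive with probability at least 1/2.\<close>

lemma survival_ge:
  assumes "t \<ge> 1"
  shows "(1/2) ^ t \<le> (1 - 1 / (128 * real t)) ^ (Suc (4 * t) * Suc (4 * t))"
proof -
  let ?q = "1 / (128 * real t)"
  have q01: "0 \<le> 1 - ?q" "1 - ?q \<le> 1" using assms by (simp_all add: divide_simps)
  have "1 / 2 \<le> 1 + real (64 * t) * (- ?q)" using assms by simp
  also have "\<dots> \<le> (1 + - ?q) ^ (64 * t)" using q01 by (intro Bernoulli_inequality) auto
  finally have "(1 / 2) ^ t \<le> ((1 - ?q) ^ (64 * t)) ^ t" by (intro power_mono) auto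
  also have "\<dots> = (1 - ?q) ^ (64 * t * t)" by (simp only: power_mult)
  also have "\<dots> \<le> (1 - ?q) ^ (Suc (4 * t) * Suc (4 * t))"
  proof (rule power_decreasing)
    have "Suc (4 * t) \<le> 8 * t" using assms by simp
    then have "Suc (4 * t) * Suc (4 * t) \<le> (8 * t) * (8 * t)" by (intro mult_le_mono)
    then show "Suc (4 * t) * Suc (4 * t) \<le> 64 * t * t" by simp
  qed (use q01 in auto)
  finally show ?thesis .
qed

text \<open>For side \<open>N = 2 ^ (4 * t)\<close> the bound \<open>2 ^ (6 * t)\<close> is
  \<open>N powr (3/2)\<close>, and \<open>2048 * t\<close> is a quarter of \<open>l\<close>. At
  least \<open>2 ^ (7 * t)\<close> entries survive on average, of which bad deletions account for at
  most \<open>2 ^ (7 * t) / 4\<close>.\<close>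

lemma exists_dense_minor_free:
  assumes t: "t \<ge> 1" and l: "l = 8192 * t"
    and deg1: "\<And>a. a < l \<Longrightarrow> 2048 * t \<le> card {b. b < l \<and> (a, b) \<in> G}"
    and deg2: "\<And>b. b < l \<Longrightarrow> 2048 * t \<le> card {a. a < l \<and> (a, b) \<in> G}"
  obtains S where "S \<subseteq> {..<2 ^ (4 * t)} \<times> {..<2 ^ (4 * t)}" "2 ^ (6 * t) \<le> card S"
    "\<not> interval_minor l G (2 ^ (4 * t)) S"
proof -
  define r where "r = 4 * t"
  define N :: nat where "N = 2 ^ r"
  define q where "q = 1 / (128 * real t)"
  define Q where "Q = nodes r \<times> nodes r"
  \<comment> \<open>\<open>w K\<close> is the probability that \<open>K\<close> is the set of
    deleted rectangles.\<close>
  define w where "w = (\<lambda>K :: (node \<times> node) set. q ^ card K * (1 - q) ^ card (Q - K))"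
  define X where "X = {..<N} \<times> {..<N}"
  define P where "P = (\<lambda>(x, y). path r x \<times> path r y)"
  define S where "S = (\<lambda>K. {p \<in> X. K \<inter> P p = {}})"
  let ?C = "configs r l"
  define bad where "bad = (\<lambda>K. \<exists>c\<in>?C. \<exists>c'\<in>?C. K \<inter> forced G c c' = {})"
  have q01: "0 \<le> q" "0 \<le> 1 - q" using t by (simp_all add: q_def divide_simps)
  have w0: "0 \<le> w K" for K using q01 by (simp add: w_def)
  have finQ: "finite Q" by (simp add: Q_def finite_nodes)
  have finX: "finite X" by (simp add: X_def)
  have finC: "finite ?C" by (rule finite_configs)
  have tot: "(\<Sum>K | K \<subseteq> Q \<and> K \<inter> U = {}. w K) = (1 - q) ^ card U" if "U \<subseteq> Q" for U
    unfolding w_def using finQ that by (rule sum_random_subset)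
  have finPow: "finite {K. K \<subseteq> Q \<and> R K}" for R
    using finQ by (rule finite_subset[rotated, OF finite_Pow_iff[THEN iffD2]]) auto
  have PQ: "P p \<subseteq> Q" if "p \<in> X" for p
    using that path_subset_nodes[of _ r] by (fastforce simp: P_def Q_def X_def N_def)
  have cardP: "card (P p) = Suc (4 * t) * Suc (4 * t)" for p
    by (simp add: P_def case_prod_unfold card_path r_def card_cartesian_product)
  have cX: "real (card X) = 2 ^ (8 * t)"
    by (simp add: X_def N_def r_def flip: power_add)
  have SX: "card (S K) \<le> card X" for K
    using finX by (intro card_mono) (auto simp: S_def)
  \<comment> \<open>The expected number of surviving entries, summed entry by entry after exchanging
    the sums.\<close>
  have lower: "2 ^ (8 * t) * (1/2) ^ t \<le> (\<Sum>K | K \<subseteq> Q. w K * real (card (S K)))"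
  proof -
    have "(\<Sum>K | K \<subseteq> Q. w K * real (card (S K))) = (\<Sum>K | K \<subseteq> Q. \<Sum>p\<in>X. if K \<inter> P p = {} then w K else 0)"
      using finX by (simp add: S_def sum.inter_filter[symmetric] mult.commute)
    also have "\<dots> = (\<Sum>p\<in>X. \<Sum>K | K \<subseteq> Q. if K \<inter> P p = {} then w K else 0)"
      by (rule sum.swap)
    also have "\<dots> = (\<Sum>p\<in>X. \<Sum>K | K \<subseteq> Q \<and> K \<inter> P p = {}. w K)"
      using finPow[of "\<lambda>_. True"] by (simp add: sum.inter_filter[symmetric])
    also have "\<dots> = (\<Sum>p\<in>X. (1 - q) ^ (Suc (4 * t) * Suc (4 * t)))"
      by (rule sum.cong[OF refl]) (simp only: tot[OF PQ] cardP)
    also have "\<dots> = 2 ^ (8 * t) * (1 - q) ^ (Suc (4 * t) * Suc (4 * t))"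
      by (simp only: sum_constant cX)
    finally show ?thesis using survival_ge[OF t] by (simp add: q_def)
  qed
  have upper: "(\<Sum>K | K \<subseteq> Q \<and> bad K. w K) \<le> (1/2) ^ t / 4"
  proof -
    have forcedQ: "forced G c c' \<subseteq> Q" if "c \<in> ?C" "c' \<in> ?C" for c c'
      using config_subset_nodes[OF that(1)] config_subset_nodes[OF that(2)]
      by (auto simp: forced_def Q_def)
    have "(\<Sum>K | K \<subseteq> Q \<and> bad K. w K)
        \<le> (\<Sum>K\<in>(\<Union>p\<in>?C \<times> ?C. {K. K \<subseteq> Q \<and> K \<inter> forced G (fst p) (snd p) = {}}). w K)"
    proof (rule sum_mono2)
      show "{K. K \<subseteq> Q \<and> bad K} \<subseteq> (\<Union>p\<in>?C \<times> ?C. {K. K \<subseteq> Q \<and> K \<inter> forced G (fst p) (snd p) = {}})"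
      proof
        fix K assume "K \<in> {K. K \<subseteq> Q \<and> bad K}"
        then obtain c c' where "K \<subseteq> Q" "c \<in> ?C" "c' \<in> ?C" "K \<inter> forced G c c' = {}"
          unfolding bad_def by blast
        then show "K \<in> (\<Union>p\<in>?C \<times> ?C. {K. K \<subseteq> Q \<and> K \<inter> forced G (fst p) (snd p) = {}})"
          by (intro UN_I[of "(c, c')"]) simp_all
      qed
      show "finite (\<Union>p\<in>?C \<times> ?C. {K. K \<subseteq> Q \<and> K \<inter> forced G (fst p) (snd p) = {}})"
        by (intro finite_UN_I finite_cartesian_product finC finPow)
    qed (rule w0)
    also have "\<dots> \<le> (\<Sum>p\<in>?C \<times> ?C. \<Sum>K | K \<subseteq> Q \<and> K \<inter> forced G (fst p) (snd p) = {}. w K)"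
      by (intro sum_UN_le finite_cartesian_product finC finPow w0)
    also have "\<dots> = (\<Sum>p\<in>?C \<times> ?C. (1 - q) ^ card (forced G (fst p) (snd p)))"
      by (intro sum.cong[OF refl] tot forcedQ) auto
    also have "\<dots> = (\<Sum>c\<in>?C. \<Sum>c'\<in>?C. (1 - q) ^ card (forced G c c'))"
      by (simp add: sum.cartesian_product case_prod_unfold)
    also have "\<dots> \<le> 4 * (1/4) ^ l"
      using random_kill_failure_le[OF q_def t deg1 deg2] .
    \<comment> \<open>Since \<open>t + 2 \<le> l\<close>; the extra factor
      \<open>(1/4)\<^sup>2\<close> turns the 4 into a quarter.\<close>
    also have "\<dots> \<le> 4 * (1/4) ^ (t + 2)"
      using t by (intro mult_left_mono power_decreasing) (auto simp: l)
    also have "\<dots> \<le> (1/2) ^ t / 4"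
      using power_mono[of "1/4" "1/2::real" t] by (simp add: power_add power2_eq_square)
    finally show ?thesis .
  qed
  \<comment> \<open>Otherwise the expectation would be at most \<open>2 ^ (6 * t)\<close> from the
    remaining deletions plus \<open>2 ^ (7 * t) / 4\<close> from the bad ones, which is less than
    \<open>2 ^ (7 * t)\<close> because \<open>2 * 2 ^ (6 * t) \<le> 2 ^ (7 * t)\<close>.\<close>
  have "\<exists>K\<subseteq>Q. \<not> bad K \<and> 2 ^ (6 * t) \<le> card (S K)"
  proof (rule ccontr)
    assume "\<not> ?thesis"
    then have small: "card (S K) \<le> 2 ^ (6 * t)" if "K \<subseteq> Q" "\<not> bad K" for K
      using that by (meson nat_le_linear)
    have "(\<Sum>K | K \<subseteq> Q. w K * real (card (S K)))
        \<le> (\<Sum>K | K \<subseteq> Q. w K * 2 ^ (6 * t) + (if bad K then w K * 2 ^ (8 * t) else 0))"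
    proof (rule sum_mono)
      fix K assume K: "K \<in> {K. K \<subseteq> Q}"
      show "w K * real (card (S K)) \<le> w K * 2 ^ (6 * t) + (if bad K then w K * 2 ^ (8 * t) else 0)"
      proof (cases "bad K")
        case True
        have "w K * real (card (S K)) \<le> w K * 2 ^ (8 * t)"
          using SX[of K] w0 by (intro mult_left_mono) (simp_all flip: cX)
        then show ?thesis using True w0[of K] by (simp add: add_increasing)
      next
        case False
        then have "real (card (S K)) \<le> 2 ^ (6 * t)"
          using of_nat_mono[OF small[of K], where ?'a = real] K by simp
        then show ?thesis using False w0[of K] by (simp add: mult_left_mono)
      qed
    qed
    \<comment> \<open>The vacuous condition \<open>K \<inter> {} = {}\<close> puts the total mass
      into the form of \<open>tot\<close>, which evaluates it to 1.\<close>
    also have "\<dots> = (\<Sum>K | K \<subseteq> Q \<and> K \<inter> {} = {}. w K) * 2 ^ (6 * t) + (\<Sum>K | K \<subseteq> Q \<and> bad K. w K) * 2 ^ (8 * t)"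
      using finPow[of "\<lambda>_. True"]
      by (simp add: sum.distrib sum_distrib_right sum.inter_filter[symmetric])
    also have "\<dots> \<le> 1 * 2 ^ (6 * t) + (1/2) ^ t / 4 * 2 ^ (8 * t)"
      by (intro add_mono mult_right_mono upper) (simp_all add: tot[of "{}", simplified])
    finally have "2 ^ (8 * t) * (1/2) ^ t \<le> (2 ^ (6 * t) + (1/2) ^ t / 4 * 2 ^ (8 * t) :: real)"
      using lower by simp
    moreover have *: "(2::real) ^ (8 * t) * (1/2) ^ t = 2 ^ (7 * t)"
    proof -
      have "(2::real) ^ (8 * t) = 2 ^ (7 * t) * 2 ^ t" by (simp flip: power_add)
      then show ?thesis by (simp add: power_one_over)
    qed
    moreover have "(2::real) * 2 ^ (6 * t) \<le> 2 ^ (7 * t)"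
      using t power_increasing[of "Suc (6 * t)" "7 * t" "2::real"] by simp
    moreover have "(1/2::real) ^ t / 4 * 2 ^ (8 * t) = 2 ^ (7 * t) / 4"
      using * by (simp add: mult.commute)
    moreover have "(0::real) < 2 ^ (7 * t)" by simp
    ultimately show False by linarith
  qed
  then obtain K where K: "K \<subseteq> Q" "\<not> bad K" "2 ^ (6 * t) \<le> card (S K)" by blast
  show ?thesis
  proof (rule that[OF _ K(3)])
    show "S K \<subseteq> {..<2 ^ (4 * t)} \<times> {..<2 ^ (4 * t)}" by (auto simp: S_def X_def N_def r_def)
    have "S K \<subseteq> {(x, y). K \<inter> path r x \<times> path r y = {}}" by (auto simp: S_def P_def)
    then show "\<not> interval_minor l G (2 ^ (4 * t)) (S K)"
      using config_minor_hits K(2) unfolding bad_def r_def by blast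
  qed
qed

section \<open>Avoiding a permutation\<close>

text \<open>\<open>f\<close> is indexed by positions and \<open>h\<close> by values, so the chosen
  rows and columns span a submatrix that dominates the permutation matrix of
  \<open>\<pi>\<close>.\<close>

definition occurs :: "(nat \<Rightarrow> nat) \<Rightarrow> nat \<Rightarrow> (nat \<times> nat) set \<Rightarrow> bool" where
  "occurs \<pi> k R \<longleftrightarrow> (\<exists>f h. strict_mono_on {..<k} f \<and> strict_mono_on {..<k} h \<and>
     (\<forall>i<k. (f i, h (\<pi> i)) \<in> R))"

text \<open>Groups consist of \<open>g\<close> consecutive positions or values; those from
  \<open>l * g\<close> on fall outside the grid.\<close>

definition blocks :: "nat \<Rightarrow> nat \<Rightarrow> nat \<Rightarrow> (nat \<Rightarrow> nat) \<Rightarrow> (nat \<times> nat) set" where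
  "blocks l g k \<pi> = {(a, b). a < l \<and> b < l \<and> (\<exists>i<k. i div g = a \<and> \<pi> i div g = b)}"

lemma separated_groups:
  fixes f :: "nat \<Rightarrow> nat"
  assumes g: "g \<ge> 1" "l * g \<le> k" and f: "strict_mono_on {..<k} f" "\<And>i. i < k \<Longrightarrow> f i < N"
  shows "separated l N (\<lambda>a. f (a * g)) (\<lambda>a. f (a * g + (g - 1)))"
    and "\<And>i. i < k \<Longrightarrow> i div g < l \<Longrightarrow> f i \<in> {f (i div g * g)..f (i div g * g + (g - 1))}"
proof -
  have mono: "f i \<le> f j" if "i \<le> j" "j < k" for i j
    using strict_mono_on_leD[OF f(1)] that by simp
  have lt: "a * g + (g - 1) < b * g" if "a < b" for a b
  proof -
    have "(a + 1) * g \<le> b * g" using that by (intro mult_le_mono1) simp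
    then show ?thesis using g by (simp add: distrib_right)
  qed
  have last: "a * g + (g - 1) < k" if "a < l" for a using lt[OF that] g(2) by linarith
  show "separated l N (\<lambda>a. f (a * g)) (\<lambda>a. f (a * g + (g - 1)))"
    unfolding separated_def
  proof (intro conjI allI impI)
    fix a assume "a < l"
    then show "f (a * g) \<le> f (a * g + (g - 1))" "f (a * g + (g - 1)) < N"
      using last f(2) by (simp_all add: mono)
  next
    fix a b assume ab: "a < b" "b < l"
    have "b * g < k" using last[OF ab(2)] by linarith
    then show "f (a * g + (g - 1)) < f (b * g)"
      using lt[OF ab(1)] strict_mono_onD[OF f(1)] by simp
  qed
  fix i assume i: "i < k" "i div g < l"
  have "i mod g < g" using g by simp
  then have "i \<le> i div g * g + (g - 1)" using div_mult_mod_eq[of i g] by linarith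
  moreover have "i div g * g \<le> i" by simp
  ultimately show "f i \<in> {f (i div g * g)..f (i div g * g + (g - 1))}"
    using mono i(1) last[OF i(2)] by simp
qed

text \<open>The rows used by a group of positions and the columns used by a group of values span the
  intervals. A point of \<open>\<pi>\<close> in a cell supplies the required entry of
  \<open>S\<close>.\<close>

lemma occurs_imp_minor:
  assumes g: "g \<ge> 1" "l * g \<le> k" and pi: "\<pi> permutes {..<k}"
    and S: "S \<subseteq> {..<N} \<times> {..<N}" and occ: "occurs \<pi> k S"
  shows "interval_minor l (blocks l g k \<pi>) N S"
proof -
  obtain f h where f: "strict_mono_on {..<k} f" and h: "strict_mono_on {..<k} h"
    and fh: "\<And>i. i < k \<Longrightarrow> (f i, h (\<pi> i)) \<in> S"
    using occ unfolding occurs_def by blast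
  have fN: "f i < N" if "i < k" for i using fh[OF that] S by auto
  \<comment> \<open>The occurrence bounds \<open>h\<close> only at values of \<open>\<pi>\<close>,
    and these exhaust \<open>{..<k}\<close>.\<close>
  have hN: "h j < N" if "j < k" for j
  proof -
    obtain i where "i < k" "\<pi> i = j" using pi \<open>j < k\<close> permutes_image[OF pi] by (metis imageE lessThan_iff)
    then show ?thesis using fh S by auto
  qed
  have pik: "\<pi> i < k" if "i < k" for i using permutes_in_image[OF pi, of i] that by simp
  have "\<exists>(x, y)\<in>S. x \<in> {f (a * g)..f (a * g + (g - 1))} \<and> y \<in> {h (b * g)..h (b * g + (g - 1))}"
    if ab: "(a, b) \<in> blocks l g k \<pi>" for a b
  proof -
    obtain i where "i < k" "i div g = a" "\<pi> i div g = b" "a < l" "b < l"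
      using ab by (auto simp: blocks_def)
    then show ?thesis
      using separated_groups(2)[OF g f fN, of i] separated_groups(2)[OF g h hN, of "\<pi> i"] fh pik
      by (intro bexI[of _ "(f i, h (\<pi> i))"]) auto
  qed
  then show ?thesis
    unfolding interval_minor_def
    using separated_groups(1)[OF g f fN] separated_groups(1)[OF g h hN] by blast
qed

section \<open>Indecomposable permutations and block copies of a matrix\<close>

lemma initial_segment_eq:
  fixes A :: "nat set"
  assumes "finite A" "\<And>i j. j \<in> A \<Longrightarrow> i \<le> j \<Longrightarrow> i \<in> A"
  shows "A = {..<card A}"
proof (cases "A = {}")
  case False
  have "A = {..Max A}" using assms False Max_in by (auto intro: assms(2)[of "Max A"])
  then show ?thesis by (metis card_atMost lessThan_Suc_atMost)
qed simp

lemma final_segment_eq: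
  fixes A :: "nat set"
  assumes "A \<subseteq> {..<k}" "\<And>i j. i \<in> A \<Longrightarrow> i \<le> j \<Longrightarrow> j < k \<Longrightarrow> j \<in> A"
  shows "A = {k - card A..<k}"
proof -
  have fin: "finite A" using assms(1) finite_subset by blast
  have "{..<k} - A = {..<card ({..<k} - A)}"
    by (rule initial_segment_eq) (use assms in auto)
  also have "card ({..<k} - A) = k - card A" using assms(1) fin by (simp add: card_Diff_subset)
  finally have eq: "{..<k} - A = {..<k - card A}" .
  have "A = {..<k} - ({..<k} - A)" using assms(1) by blast
  also have "\<dots> = {k - card A..<k}" unfolding eq by auto
  finally show ?thesis .
qed

definition sum_decomposable :: "nat \<Rightarrow> (nat \<Rightarrow> nat) \<Rightarrow> bool" where
  "sum_decomposable k \<pi> \<longleftrightarrow> (\<exists>m. 0 < m \<and> m < k \<and> \<pi> ` {..<m} = {..<m})"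

definition skew_decomposable :: "nat \<Rightarrow> (nat \<Rightarrow> nat) \<Rightarrow> bool" where
  "skew_decomposable k \<pi> \<longleftrightarrow> (\<exists>m. 0 < m \<and> m < k \<and> \<pi> ` {..<m} = {k - m..<k})"

text \<open>If \<open>m \<le> m'\<close>, the value 0 is taken on the first \<open>m\<close>
  positions, yet values there are at least \<open>k - m' > 0\<close>. Otherwise the value
  \<open>k - 1\<close> is taken on the first \<open>m'\<close> positions, yet values there are below
  \<open>m < k\<close>.\<close>

lemma not_sum_and_skew_decomposable: "\<not> (sum_decomposable k \<pi> \<and> skew_decomposable k \<pi>)"
proof
  assume "sum_decomposable k \<pi> \<and> skew_decomposable k \<pi>"
  then obtain m m' where m: "0 < m" "m < k" "\<pi> ` {..<m} = {..<m}"
    and m': "0 < m'" "m' < k" "\<pi> ` {..<m'} = {k - m'..<k}"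
    by (auto simp: sum_decomposable_def skew_decomposable_def)
  show False
  proof (cases "m \<le> m'")
    case True
    then have "\<pi> ` {..<m} \<subseteq> \<pi> ` {..<m'}" by (intro image_mono) auto
    then have "0 \<in> {k - m'..<k}" using m m' by auto
    then show False using m' by simp
  next
    case False
    then have "\<pi> ` {..<m'} \<subseteq> \<pi> ` {..<m}" by (intro image_mono) auto
    then have "k - 1 \<in> {..<m}" using m m' by (auto simp: subset_eq)
    then show False using m by simp
  qed
qed

text \<open>With \<open>\<sigma>\<close> the identity or the reversal, the copies of
  \<open>S\<close> lie along the diagonal or the antidiagonal of a \<open>B\<close> by
  \<open>B\<close> block matrix.\<close>

definition copies :: "nat \<Rightarrow> (nat \<Rightarrow> nat) \<Rightarrow> nat \<Rightarrow> (nat \<times> nat) set \<Rightarrow> (nat \<times> nat) set" where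
  "copies N \<sigma> B S = {(x, y). x div N < B \<and> y div N = \<sigma> (x div N) \<and> (x mod N, y mod N) \<in> S}"

lemma copies_eq:
  assumes "S \<subseteq> {..<N} \<times> {..<N}"
  shows "copies N \<sigma> B S = (\<lambda>(b, x, y). (b * N + x, \<sigma> b * N + y)) ` ({..<B} \<times> S)"
proof (intro set_eqI iffI)
  fix p assume "p \<in> copies N \<sigma> B S"
  then obtain x y where "p = (x, y)" "x div N < B" "y div N = \<sigma> (x div N)" "(x mod N, y mod N) \<in> S"
    by (auto simp: copies_def)
  then show "p \<in> (\<lambda>(b, x, y). (b * N + x, \<sigma> b * N + y)) ` ({..<B} \<times> S)"
    by (intro image_eqI[of _ _ "(x div N, x mod N, y mod N)"]) (auto simp flip: \<open>y div N = _\<close>)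
qed (use assms in \<open>auto simp: copies_def\<close>)

lemma copies_card:
  assumes "S \<subseteq> {..<N} \<times> {..<N}"
  shows "card (copies N \<sigma> B S) = B * card S"
proof -
  have eq: "b = b' \<and> x = x'" if "b * N + x = b' * N + x'" "x < N" "x' < N" for b b' x x' :: nat
  proof -
    have "(b * N + x) div N = (b' * N + x') div N" "(b * N + x) mod N = (b' * N + x') mod N"
      using that(1) by simp_all
    then show ?thesis using that(2,3) by simp
  qed
  have "inj_on (\<lambda>(b, x, y). (b * N + x, \<sigma> b * N + y)) ({..<B} \<times> S)"
    using assms by (intro inj_onI) (fastforce dest: eq)
  then show ?thesis by (simp add: copies_eq[OF assms] card_image card_cartesian_product)
qed

lemma copies_subset:
  assumes "S \<subseteq> {..<N} \<times> {..<N}" "\<And>b. b < B \<Longrightarrow> \<sigma> b < B"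
  shows "copies N \<sigma> B S \<subseteq> {..<B * N} \<times> {..<B * N}"
proof -
  have "N > 0" if "(x, y) \<in> S" for x y using assms that by auto
  then show ?thesis
    using assms by (auto simp: copies_def div_less_iff_less_mult[symmetric])
qed

text \<open>The positions placed in the same block row as position 0 form an initial segment. Their
  values form an initial segment on the diagonal and a final segment on the antidiagonal. If some
  position were outside, this would decompose \<open>\<pi>\<close>; so one block holds
  everything.\<close>

lemma occurs_copies_one_block:
  assumes occ: "occurs \<pi> k (copies N \<sigma> B S)" and pi: "\<pi> permutes {..<k}"
    and indec: "\<sigma> = id \<and> \<not> sum_decomposable k \<pi> \<or> \<sigma> = (\<lambda>b. B - 1 - b) \<and> \<not> skew_decomposable k \<pi>"
  shows "occurs \<pi> k S"
proof -
  obtain f h where f: "strict_mono_on {..<k} f" and h: "strict_mono_on {..<k} h"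
    and fh: "\<And>i. i < k \<Longrightarrow> (f i, h (\<pi> i)) \<in> copies N \<sigma> B S"
    using occ unfolding occurs_def by blast
  define \<phi> where "\<phi> i = f i div N" for i
  define \<psi> where "\<psi> j = h j div N" for j
  have mono: "\<phi> i \<le> \<phi> j" "\<psi> i \<le> \<psi> j" if "i \<le> j" "j < k" for i j
    using strict_mono_on_leD[OF f, of i j] strict_mono_on_leD[OF h, of i j] that
    by (simp_all add: \<phi>_def \<psi>_def div_le_mono)
  have link: "\<phi> i < B" "\<psi> (\<pi> i) = \<sigma> (\<phi> i)" "(f i mod N, h (\<pi> i) mod N) \<in> S" if "i < k" for i
    using fh[OF that] by (auto simp: copies_def \<phi>_def \<psi>_def)
  have pik: "\<pi> i < k" if "i < k" for i using permutes_in_image[OF pi, of i] that by simp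
  have surj: "\<exists>i<k. \<pi> i = j" if "j < k" for j
    using permutes_image[OF pi] that by (metis imageE lessThan_iff)
  have const: "\<phi> i = \<phi> 0" if i: "i < k" for i
  proof (rule ccontr)
    assume ne: "\<phi> i \<noteq> \<phi> 0"
    define A where "A = {i. i < k \<and> \<phi> i = \<phi> 0}"
    have fin: "finite A" by (simp add: A_def)
    have A: "A = {..<card A}"
    proof (rule initial_segment_eq[OF fin])
      fix i j assume "j \<in> A" "i \<le> j"
      then show "i \<in> A" using mono(1)[of i j] mono(1)[of 0 i] by (auto simp: A_def)
    qed
    have "0 \<in> A" using i by (simp add: A_def)
    then have pos: "0 < card A" using fin by (auto simp: card_gt_0_iff)
    have "A \<subset> {..<k}" using i ne by (auto simp: A_def)
    then have less: "card A < k" using psubset_card_mono[of "{..<k}" A] by simp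
    have cardpi: "card (\<pi> ` A) = card A"
      by (rule card_image) (rule inj_on_subset[OF permutes_inj[OF pi]], simp)
    from indec show False
    proof
      assume id: "\<sigma> = id \<and> \<not> sum_decomposable k \<pi>"
      have "\<pi> ` A = {..<card (\<pi> ` A)}"
      proof (rule initial_segment_eq)
        fix j' j assume j: "j \<in> \<pi> ` A" "j' \<le> j"
        then obtain i where i: "i \<in> A" "j = \<pi> i" by blast
        have jk: "j < k" using i pik by (auto simp: A_def)
        obtain i' where i': "i' < k" "\<pi> i' = j'" using surj[of j'] j(2) jk by auto
        have "\<phi> i' \<le> \<phi> 0"
          using mono(2)[OF j(2) jk] link(2)[of i] link(2)[OF i'(1)] i i' id by (simp add: A_def)
        then have "i' \<in> A" using mono(1)[of 0 i'] i'(1) by (simp add: A_def)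
        then show "j' \<in> \<pi> ` A" using i'(2) by blast
      qed (use fin in simp)
      then have "\<pi> ` {..<card A} = {..<card A}" using A cardpi by metis
      then show False using id pos less by (auto simp: sum_decomposable_def)
    next
      assume skew: "\<sigma> = (\<lambda>b. B - 1 - b) \<and> \<not> skew_decomposable k \<pi>"
      have "\<pi> ` A = {k - card (\<pi> ` A)..<k}"
      proof (rule final_segment_eq)
        show "\<pi> ` A \<subseteq> {..<k}" using pik by (auto simp: A_def)
        fix j j' assume j: "j \<in> \<pi> ` A" "j \<le> j'" "j' < k"
        then obtain i where i: "i \<in> A" "j = \<pi> i" by blast
        obtain i' where i': "i' < k" "\<pi> i' = j'" using surj[OF j(3)] by blast
        have "B - 1 - \<phi> 0 \<le> B - 1 - \<phi> i'"
          using mono(2)[OF j(2,3)] link(2)[of i] link(2)[OF i'(1)] i i' skew by (simp add: A_def)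
        \<comment> \<open>The truncated subtraction can be undone because both block indices are
          below \<open>B\<close>.\<close>
        then have "\<phi> i' \<le> \<phi> 0" using link(1)[OF i'(1)] link(1)[of 0] i'(1) by linarith
        then have "i' \<in> A" using mono(1)[of 0 i'] i'(1) by (simp add: A_def)
        then show "j' \<in> \<pi> ` A" using i'(2) by blast
      qed
      then have "\<pi> ` {..<card A} = {k - card A..<k}" using A cardpi by metis
      then show False using skew pos less by (auto simp: skew_decomposable_def)
    qed
  qed
  have const2: "\<psi> j = \<sigma> (\<phi> 0)" if "j < k" for j
    using surj[OF that] link(2) const by metis
  \<comment> \<open>Inside one block all quotients agree, so the remainders carry the order.\<close>
  have shift: "strict_mono_on {..<k} (\<lambda>i. u i mod N)"
    if u: "strict_mono_on {..<k} u" "\<And>i. i < k \<Longrightarrow> u i div N = b" for u b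
  proof (rule strict_mono_onI)
    fix i j assume ij: "i \<in> {..<k}" "j \<in> {..<k}" "i < j"
    have "u i < u j" using strict_mono_onD[OF u(1)] ij by blast
    moreover have "u i div N = b" "u j div N = b" using u(2) ij by auto
    then have "u i = b * N + u i mod N" "u j = b * N + u j mod N" by (metis div_mult_mod_eq)+
    ultimately show "u i mod N < u j mod N" by linarith
  qed
  show ?thesis
    unfolding occurs_def
  proof (intro exI conjI allI impI)
    show "strict_mono_on {..<k} (\<lambda>i. f i mod N)" by (rule shift[OF f const[unfolded \<phi>_def]])
    show "strict_mono_on {..<k} (\<lambda>j. h j mod N)" by (rule shift[OF h const2[unfolded \<psi>_def]])
  qed (rule link(3))
qed

lemma dense_avoiding_matrix:
  assumes t: "t \<ge> 1" and l: "l = 8192 * t" and g: "g \<ge> 1" "l * g \<le> k" and pi: "\<pi> permutes {..<k}"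
    and deg1: "\<And>a. a < l \<Longrightarrow> 2048 * t \<le> card {b. b < l \<and> (a, b) \<in> blocks l g k \<pi>}"
    and deg2: "\<And>b. b < l \<Longrightarrow> 2048 * t \<le> card {a. a < l \<and> (a, b) \<in> blocks l g k \<pi>}"
  obtains R where "R \<subseteq> {..<B * 2 ^ (4 * t)} \<times> {..<B * 2 ^ (4 * t)}" "B * 2 ^ (6 * t) \<le> card R"
    "\<not> occurs \<pi> k R"
proof -
  define N :: nat where "N = 2 ^ (4 * t)"
  obtain S where S: "S \<subseteq> {..<N} \<times> {..<N}" "2 ^ (6 * t) \<le> card S"
    "\<not> interval_minor l (blocks l g k \<pi>) N S"
    using exists_dense_minor_free[OF t l deg1 deg2] unfolding N_def by blast
  have no: "\<not> occurs \<pi> k S" using occurs_imp_minor[OF g pi S(1)] S(3) by blast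
  \<comment> \<open>No permutation decomposes both ways, so one of the two arrangements is
    safe.\<close>
  obtain \<sigma> where \<sigma>: "\<sigma> = id \<and> \<not> sum_decomposable k \<pi> \<or> \<sigma> = (\<lambda>b. B - 1 - b) \<and> \<not> skew_decomposable k \<pi>"
    using not_sum_and_skew_decomposable by blast
  then have "\<sigma> b < B" if "b < B" for b using that by auto
  then have "copies N \<sigma> B S \<subseteq> {..<B * N} \<times> {..<B * N}" by (rule copies_subset[OF S(1)])
  moreover have "B * 2 ^ (6 * t) \<le> card (copies N \<sigma> B S)" using S(2) by (simp add: copies_card[OF S(1)])
  moreover have "\<not> occurs \<pi> k (copies N \<sigma> B S)" using occurs_copies_one_block[OF _ pi \<sigma>] no by blast
  ultimately show ?thesis using that unfolding N_def by blast
qed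

section \<open>Random permutations\<close>

text \<open>Reveal a random permutation on \<open>X\<close> one position at a time. After
  \<open>card X\<close> values in \<open>S\<close>, the next one is in \<open>S\<close> with
  conditional probability \<open>(card S - card X) / (k - card X) \<le> card S / k\<close>.\<close>

lemma card_permutes_into:
  fixes k :: nat
  assumes S: "S \<subseteq> {..<k}" and X: "X \<subseteq> {..<k}"
  shows "real (card {\<pi>. \<pi> permutes {..<k} \<and> \<pi> ` X \<subseteq> S}) \<le> (card S / k) ^ card X * fact k"
proof -
  have "finite X" using X finite_subset by blast
  then show ?thesis using X
  proof (induction X rule: finite_induct)
    case empty
    then show ?case by (simp add: card_permutations)
  next
    case (insert x X)
    define C where "C = (\<lambda>Y. {\<pi>. \<pi> permutes {..<k} \<and> \<pi> ` Y \<subseteq> S})"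
    have finC: "finite (C Y)" for Y
      unfolding C_def by (rule finite_subset[OF _ finite_permutations[of "{..<k}"]]) auto
    let ?Z = "{..<k} - X"
    have cardZ: "card ?Z = k - card X" using insert by (simp add: card_Diff_subset)
    have xZ: "x \<in> ?Z" and Xk: "X \<subseteq> {..<k}" using insert by auto
    have "card X < card {..<k}"
      by (rule psubset_card_mono) (use insert in auto)
    then have less: "card X < k" by simp
    \<comment> \<open>By symmetry the new position may be any one outside \<open>X\<close>, so the
      count can be averaged over all of them.\<close>
    have swap: "card (C (insert y X)) \<le> card (C (insert x X))" if x: "x \<in> ?Z" and y: "y \<in> ?Z" for x y
    proof (rule card_inj_on_le[of "\<lambda>\<pi>. \<pi> \<circ> transpose x y"])
      show "inj_on (\<lambda>\<pi>. \<pi> \<circ> transpose x y) (C (insert y X))"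
        by (rule inj_onI) (metis comp_assoc comp_id transpose_comp_involutory)
      show "(\<lambda>\<pi>. \<pi> \<circ> transpose x y) ` C (insert y X) \<subseteq> C (insert x X)"
      proof
        fix \<pi>' assume "\<pi>' \<in> (\<lambda>\<pi>. \<pi> \<circ> transpose x y) ` C (insert y X)"
        then obtain \<pi> where p: "\<pi>' = \<pi> \<circ> transpose x y" "\<pi> permutes {..<k}" "\<pi> ` insert y X \<subseteq> S"
          by (auto simp: C_def)
        have "\<pi>' permutes {..<k}"
          unfolding p(1) by (rule permutes_compose[OF _ p(2)]) (use x y in \<open>auto intro: permutes_swap_id\<close>)
        moreover have "transpose x y z = z" if "z \<in> X" for z
          using that x y by (auto simp: transpose_def)
        then have "\<pi>' ` insert x X \<subseteq> S" using p(3) by (auto simp: p(1))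
        ultimately show "\<pi>' \<in> C (insert x X)" by (simp add: C_def)
      qed
    qed (rule finC)
    have fibre: "card {y \<in> ?Z. \<pi> y \<in> S} = card S - card X" if "\<pi> \<in> C X" for \<pi>
    proof -
      have p: "\<pi> permutes {..<k}" "\<pi> ` X \<subseteq> S" using that by (auto simp: C_def)
      have inj: "inj \<pi>" using p(1) by (rule permutes_inj)
      have "\<pi> ` {y \<in> ?Z. \<pi> y \<in> S} = S - \<pi> ` X"
      proof
        show "\<pi> ` {y \<in> ?Z. \<pi> y \<in> S} \<subseteq> S - \<pi> ` X" using inj by (auto simp: inj_def)
        show "S - \<pi> ` X \<subseteq> \<pi> ` {y \<in> ?Z. \<pi> y \<in> S}"
        proof
          fix s assume s: "s \<in> S - \<pi> ` X"
          then have "s \<in> \<pi> ` {..<k}" using S permutes_image[OF p(1)] by auto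
          then show "s \<in> \<pi> ` {y \<in> ?Z. \<pi> y \<in> S}" using s by blast
        qed
      qed
      then have "card {y \<in> ?Z. \<pi> y \<in> S} = card (S - \<pi> ` X)"
        using card_image[OF inj_on_subset[OF inj subset_UNIV], of "{y \<in> ?Z. \<pi> y \<in> S}"] by simp
      also have "\<dots> = card S - card X"
        using p(2) insert.hyps(1) inj by (simp add: card_Diff_subset card_image inj_on_subset)
      finally show ?thesis .
    qed
    \<comment> \<open>Double counting of pairs of a permutation in \<open>C X\<close> and a position
      outside \<open>X\<close> that it sends into \<open>S\<close>.\<close>
    have "(k - card X) * card (C (insert x X)) = (\<Sum>y\<in>?Z. card (C (insert y X)))"
    proof -
      have "card (C (insert y X)) = card (C (insert x X))" if "y \<in> ?Z" for y
        using swap[OF xZ that] swap[OF that xZ] by (rule antisym)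
      then show ?thesis by (simp add: cardZ)
    qed
    also have "\<dots> = (\<Sum>y\<in>?Z. \<Sum>\<pi>\<in>C X. if \<pi> y \<in> S then 1 else 0)"
    proof (rule sum.cong[OF refl])
      fix y
      have "C (insert y X) = {\<pi> \<in> C X. \<pi> y \<in> S}" by (auto simp: C_def)
      then show "card (C (insert y X)) = (\<Sum>\<pi>\<in>C X. if \<pi> y \<in> S then 1 else 0)"
        using finC by (simp add: sum.inter_filter[symmetric])
    qed
    also have "\<dots> = (\<Sum>\<pi>\<in>C X. card {y \<in> ?Z. \<pi> y \<in> S})"
      by (subst sum.swap) (simp add: sum.inter_filter[symmetric])
    also have "\<dots> = card (C X) * (card S - card X)" using fibre by simp
    finally have eq: "(k - card X) * card (C (insert x X)) = card (C X) * (card S - card X)" .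
    have Sk: "card S \<le> k" using card_mono[OF _ S] by simp
    \<comment> \<open>If \<open>card X\<close> exceeds \<open>card S\<close>, truncated subtraction
      makes the left side 0.\<close>
    have ratio: "real (card S - card X) / real (k - card X) \<le> card S / k"
    proof (cases "card X \<le> card S")
      case True
      have "real (card X) * real (card S) \<le> real (card X) * real k" using Sk by (intro mult_left_mono) auto
      then show ?thesis using True less Sk by (simp add: of_nat_diff divide_simps algebra_simps)
    qed simp
    have "real (card (C (insert x X))) = card (C X) * (real (card S - card X) / real (k - card X))"
      using arg_cong[OF eq, of real] less by (simp add: field_simps)
    also have "\<dots> \<le> ((card S / k) ^ card X * fact k) * (card S / k)"
      using insert.IH[OF Xk] ratio by (intro mult_mono) (auto simp: C_def)
    finally show ?case using insert.hyps by (simp add: C_def mult_ac)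
  qed
qed

text \<open>The hypotheses of \<open>dense_avoiding_matrix\<close> with groups of size
  \<open>k div l\<close>: a quarter of the cells of each row and column of the grid.\<close>

definition spread :: "nat \<Rightarrow> nat \<Rightarrow> (nat \<Rightarrow> nat) \<Rightarrow> bool" where
  "spread t k \<pi> \<longleftrightarrow>
     (\<forall>a<8192 * t. 2048 * t \<le> card {b. b < 8192 * t \<and> (a, b) \<in> blocks (8192 * t) (k div (8192 * t)) k \<pi>}) \<and>
     (\<forall>b<8192 * t. 2048 * t \<le> card {a. a < 8192 * t \<and> (a, b) \<in> blocks (8192 * t) (k div (8192 * t)) k \<pi>})"

text \<open>A failing row sends its \<open>g\<close> positions into fewer than \<open>l / 4\<close>
  groups and the leftover values, at most \<open>k / 2\<close> values in all. Each choice of groups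
  thus has probability at most \<open>(1/2) ^ g\<close>, and \<open>g \<ge> 4 * l\<close> beats the
  at most \<open>2 ^ l\<close> choices.\<close>

lemma card_few_blocks:
  assumes t: "t \<ge> 1" and l: "l = 8192 * t" and k: "4 * l * l \<le> k" and a: "a < l"
  shows "real (card {\<pi>. \<pi> permutes {..<k} \<and> card {b. b < l \<and> (a, b) \<in> blocks l (k div l) k \<pi>} < 2048 * t})
    \<le> (1/8) ^ l * fact k"
proof -
  define g where "g = k div l"
  define X where "X = {a * g..<a * g + g}"
  \<comment> \<open>Values from \<open>l * g\<close> on lie in no group, so every target set must
    admit them.\<close>
  define S where "S = (\<lambda>B. {v. v < k \<and> (v div g \<in> B \<or> l * g \<le> v)})"
  let ?B = "{B. B \<subseteq> {..<l} \<and> card B < 2048 * t}"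
  have l1: "l \<ge> 1" using t l by simp
  have g4: "4 * l \<le> g" unfolding g_def using k l1 by (simp add: less_eq_div_iff_mult_less_eq mult.assoc)
  have lg: "l * g \<le> k" "k < l * g + l"
    using l1 mult_div_mod_eq[of l k] mod_less_divisor[of l k] unfolding g_def by linarith+
  have "(a + 1) * g \<le> l * g" using a by (intro mult_le_mono1) simp
  then have X: "X \<subseteq> {..<k}" using lg(1) by (auto simp: X_def)
  have Xg: "i div g = a" if "i \<in> X" for i
    using that by (auto simp: X_def intro!: div_nat_eqI simp: algebra_simps)
  have finB: "finite ?B" by (rule finite_subset[of _ "Pow {..<l}"]) auto
  have "{\<pi>. \<pi> permutes {..<k} \<and> card {b. b < l \<and> (a, b) \<in> blocks l g k \<pi>} < 2048 * t}
      \<subseteq> (\<Union>B\<in>?B. {\<pi>. \<pi> permutes {..<k} \<and> \<pi> ` X \<subseteq> S B})"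
  proof
    fix \<pi> assume "\<pi> \<in> {\<pi>. \<pi> permutes {..<k} \<and> card {b. b < l \<and> (a, b) \<in> blocks l g k \<pi>} < 2048 * t}"
    then have p: "\<pi> permutes {..<k}" "card {b. b < l \<and> (a, b) \<in> blocks l g k \<pi>} < 2048 * t" by auto
    have "\<pi> ` X \<subseteq> S {b. b < l \<and> (a, b) \<in> blocks l g k \<pi>}"
    proof
      fix v assume "v \<in> \<pi> ` X"
      then obtain i where i: "i \<in> X" "v = \<pi> i" by blast
      have ik: "i < k" "v < k" using i X permutes_in_image[OF p(1), of i] by auto
      have "v div g < l \<or> l * g \<le> v"
        using g4 l1 by (auto simp: div_less_iff_less_mult)
      then show "v \<in> S {b. b < l \<and> (a, b) \<in> blocks l g k \<pi>}"
        using ik i Xg a by (auto simp: S_def blocks_def)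
    qed
    then show "\<pi> \<in> (\<Union>B\<in>?B. {\<pi>. \<pi> permutes {..<k} \<and> \<pi> ` X \<subseteq> S B})"
      using p by (intro UN_I[of "{b. b < l \<and> (a, b) \<in> blocks l g k \<pi>}"]) auto
  qed
  then have "card {\<pi>. \<pi> permutes {..<k} \<and> card {b. b < l \<and> (a, b) \<in> blocks l g k \<pi>} < 2048 * t}
      \<le> card (\<Union>B\<in>?B. {\<pi>. \<pi> permutes {..<k} \<and> \<pi> ` X \<subseteq> S B})"
    by (rule card_mono[rotated])
      (rule finite_subset[OF _ finite_permutations[of "{..<k}"]], auto)
  also have "\<dots> \<le> (\<Sum>B\<in>?B. card {\<pi>. \<pi> permutes {..<k} \<and> \<pi> ` X \<subseteq> S B})"
    using finB by (rule card_UN_le)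
  finally have "real (card {\<pi>. \<pi> permutes {..<k} \<and> card {b. b < l \<and> (a, b) \<in> blocks l g k \<pi>} < 2048 * t})
      \<le> (\<Sum>B\<in>?B. real (card {\<pi>. \<pi> permutes {..<k} \<and> \<pi> ` X \<subseteq> S B}))"
    unfolding of_nat_sum[symmetric] of_nat_le_iff .
  also have "\<dots> \<le> (\<Sum>B\<in>?B. (1/2) ^ g * fact k)"
  proof (rule sum_mono)
    fix B assume B: "B \<in> ?B"
    have finB: "finite B" using B finite_subset by auto
    have "S B \<subseteq> (\<Union>b\<in>B. {b * g..<b * g + g}) \<union> {l * g..<k}"
    proof
      fix v assume "v \<in> S B"
      moreover have "v div g * g \<le> v" "v < v div g * g + g"
        using g4 l1 div_mult_mod_eq[of v g] mod_less_divisor[of g v] by linarith+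
      ultimately show "v \<in> (\<Union>b\<in>B. {b * g..<b * g + g}) \<union> {l * g..<k}" by (auto simp: S_def intro!: bexI[of _ "v div g"])
    qed
    then have "card (S B) \<le> card ((\<Union>b\<in>B. {b * g..<b * g + g}) \<union> {l * g..<k})"
      using finB by (intro card_mono) auto
    also have "\<dots> \<le> (\<Sum>b\<in>B. card {b * g..<b * g + g}) + card {l * g..<k}"
      using card_UN_le[OF finB, of "\<lambda>b. {b * g..<b * g + g}"] by (meson add_le_mono1 card_Un_le le_trans)
    also have "\<dots> = card B * g + (k - l * g)" by simp
    also have "\<dots> \<le> 2048 * t * g + (k - l * g)" using B by (intro add_le_mono mult_le_mono1) auto
    finally have "card (S B) \<le> 2048 * t * g + (k - l * g)" .
    moreover have "l * g = 4 * (2048 * t * g)" by (simp add: l)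
    \<comment> \<open>Fewer than \<open>l\<close> values are left over, so they cost at most another
      quarter of \<open>k\<close>.\<close>
    moreover have "4 * l \<le> k"
    proof -
      have "4 * l * 1 \<le> 4 * l * l" using l1 by (intro mult_le_mono2)
      then show ?thesis using k by linarith
    qed
    ultimately have "2 * card (S B) \<le> k" using lg by linarith
    moreover have "k > 0" using k l1 by (cases k) auto
    ultimately have half: "real (card (S B)) / k \<le> 1/2" by (simp add: divide_simps)
    have "real (card {\<pi>. \<pi> permutes {..<k} \<and> \<pi> ` X \<subseteq> S B}) \<le> (card (S B) / k) ^ card X * fact k"
      by (rule card_permutes_into[OF _ X]) (auto simp: S_def)
    also have "\<dots> \<le> (1/2) ^ card X * fact k"
      using half by (intro mult_right_mono power_mono) auto
    finally show "real (card {\<pi>. \<pi> permutes {..<k} \<and> \<pi> ` X \<subseteq> S B}) \<le> (1/2) ^ g * fact k"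
      by (simp add: X_def)
  qed
  also have "\<dots> = real (card ?B) * ((1/2) ^ g * fact k)" by simp
  also have "\<dots> \<le> 2 ^ l * ((1/2) ^ (4 * l) * fact k)"
  proof (intro mult_mono)
    have "card ?B \<le> card (Pow {..<l})" by (rule card_mono) auto
    then show "real (card ?B) \<le> 2 ^ l"
      using of_nat_mono[of "card ?B" "2 ^ l", where ?'a = real] by (simp add: card_Pow)
    show "(1/2) ^ g \<le> (1/2::real) ^ (4 * l)" using g4 by (intro power_decreasing) auto
  qed auto
  also have "\<dots> = (1/8) ^ l * fact k"
  proof -
    have "2 ^ l * (1/2) ^ (4 * l) = (1/8::real) ^ l"
      unfolding power_mult power_mult_distrib[symmetric] by (simp add: power4_eq_xxxx)
    then show ?thesis by simp
  qed
  finally show ?thesis by (simp add: g_def)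
qed

lemma blocks_inv:
  assumes "\<pi> permutes {..<k}"
  shows "(a, b) \<in> blocks l g k (inv \<pi>) \<longleftrightarrow> (b, a) \<in> blocks l g k \<pi>"
proof -
  have *: "\<pi> (inv \<pi> i) = i" "inv \<pi> (\<pi> i) = i" for i
    using permutes_inverses[OF assms] by auto
  have "\<pi> i < k \<longleftrightarrow> i < k" "inv \<pi> i < k \<longleftrightarrow> i < k" for i
    using permutes_in_image[OF assms, of i] permutes_in_image[OF permutes_inv[OF assms], of i] by auto
  then show ?thesis unfolding blocks_def using * by (auto; metis)
qed

text \<open>Union bound over rows and columns. Inversion transposes the grid, so the columns of
  \<open>\<pi>\<close> are the rows of its inverse.\<close>

lemma card_not_spread:
  assumes t: "t \<ge> 1" and k: "4 * (8192 * t) * (8192 * t) \<le> k"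
  shows "real (card {\<pi>. \<pi> permutes {..<k} \<and> \<not> spread t k \<pi>}) \<le> 2 * (1/4) ^ t * fact k"
proof -
  define l where "l = 8192 * t"
  let ?row = "\<lambda>a. {\<pi>. \<pi> permutes {..<k} \<and> card {b. b < l \<and> (a, b) \<in> blocks l (k div l) k \<pi>} < 2048 * t}"
  let ?col = "\<lambda>b. {\<pi>. \<pi> permutes {..<k} \<and> card {a. a < l \<and> (a, b) \<in> blocks l (k div l) k \<pi>} < 2048 * t}"
  have fin: "finite {\<pi>. \<pi> permutes {..<k} \<and> Q \<pi>}" for Q
    by (rule finite_subset[OF _ finite_permutations[of "{..<k}"]]) auto
  have row: "real (card (?row a)) \<le> (1/8) ^ l * fact k" if "a < l" for a
    using card_few_blocks[OF t l_def _ that] k by (simp add: l_def)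
  have col: "card (?col b) \<le> card (?row b)" for b
  proof (rule card_inj_on_le[of inv])
    show "inj_on inv (?col b)" by (rule inj_onI) (metis (mono_tags, lifting) mem_Collect_eq permutes_inv_inv)
    show "inv ` ?col b \<subseteq> ?row b" using blocks_inv by (auto simp: permutes_inv)
  qed (rule fin)
  have "{\<pi>. \<pi> permutes {..<k} \<and> \<not> spread t k \<pi>} \<subseteq> (\<Union>a<l. ?row a) \<union> (\<Union>a<l. ?col a)"
    by (auto simp: spread_def l_def not_le)
  then have "card {\<pi>. \<pi> permutes {..<k} \<and> \<not> spread t k \<pi>} \<le> card ((\<Union>a<l. ?row a) \<union> (\<Union>a<l. ?col a))"
    by (rule card_mono[rotated]) (intro finite_UnI finite_UN_I fin finite_lessThan)
  also have "\<dots> \<le> (\<Sum>a<l. card (?row a)) + (\<Sum>a<l. card (?col a))"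
    by (rule order_trans[OF card_Un_le]) (intro add_mono card_UN_le finite_lessThan)
  also have "\<dots> \<le> (\<Sum>a<l. card (?row a)) + (\<Sum>a<l. card (?row a))"
    by (intro add_mono sum_mono col order_refl)
  finally have "real (card {\<pi>. \<pi> permutes {..<k} \<and> \<not> spread t k \<pi>}) \<le> 2 * (\<Sum>a<l. real (card (?row a)))"
    using of_nat_mono[where ?'a = real] by fastforce
  also have "\<dots> \<le> 2 * (\<Sum>a<l. (1/8) ^ l * fact k)"
    by (intro mult_left_mono sum_mono row) auto
  also have "\<dots> = 2 * (real l * (1/8) ^ l) * fact k" by simp
  \<comment> \<open>The crude bound \<open>l \<le> 2 ^ l\<close> absorbs the number of rows.\<close>
  also have "\<dots> \<le> 2 * (2 ^ l * (1/8) ^ l) * fact k"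
    using of_nat_less_two_power[of l, where ?'a = real]
    by (intro mult_right_mono mult_left_mono) auto
  also have "2 ^ l * (1/8) ^ l = (1/4::real) ^ l" by (simp flip: power_mult_distrib)
  also have "2 * (1/4) ^ l * fact k \<le> 2 * (1/4::real) ^ t * fact k"
    by (intro mult_right_mono mult_left_mono power_decreasing) (auto simp: l_def)
  finally show ?thesis .
qed

section \<open>Permutation hypergraphs\<close>

lemma permutation_hypergraphD:
  assumes "permutation_hypergraph d k P"
  shows "verts P = {1..k * d}" "\<And>e. e \<in> edges P \<Longrightarrow> e \<subseteq> {1..k * d}"
    "\<And>e. e \<in> edges P \<Longrightarrow> finite e \<and> card e = d"
    "\<And>e i x y. e \<in> edges P \<Longrightarrow> i \<in> {1..d} \<Longrightarrow> x \<in> e \<Longrightarrow> y \<in> e \<Longrightarrow> x \<in> {(i - 1) * k + 1..i * k} \<Longrightarrow>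
       y \<in> {(i - 1) * k + 1..i * k} \<Longrightarrow> x = y"
    "\<And>v. v \<in> {1..k * d} \<Longrightarrow> \<exists>!e. e \<in> edges P \<and> v \<in> e"
proof -
  show V: "verts P = {1..k * d}" using assms by (simp add: permutation_hypergraph_def)
  show "e \<subseteq> {1..k * d}" if "e \<in> edges P" for e
    using assms that V by (auto simp only: permutation_hypergraph_def ordered_hypergraph_def)
  show "finite e \<and> card e = d" if "e \<in> edges P" for e
    using assms that by (simp only: permutation_hypergraph_def uniform_def)
  have "\<forall>e\<in>edges P. \<forall>i\<in>{1..d}. \<forall>x\<in>e \<inter> {(i - 1) * k + 1..i * k}. \<forall>y\<in>e \<inter> {(i - 1) * k + 1..i * k}. x = y"
    using assms unfolding permutation_hypergraph_def partite_with_def by (elim conjE)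
  then show "x = y" if "e \<in> edges P" "i \<in> {1..d}" "x \<in> e" "y \<in> e" "x \<in> {(i - 1) * k + 1..i * k}"
    "y \<in> {(i - 1) * k + 1..i * k}" for e i x y
    using that by (meson IntI)
  show "\<exists>!e. e \<in> edges P \<and> v \<in> e" if "v \<in> {1..k * d}" for v
    using assms that by (simp only: permutation_hypergraph_def)
qed

text \<open>Pigeonhole: \<open>d\<close> vertices are spread over \<open>d\<close> parts with at
  most one in each.\<close>

lemma edge_meets_part:
  assumes P: "permutation_hypergraph d k P" and e: "e \<in> edges P" and i: "i \<in> {1..d}"
  shows "\<exists>x. e \<inter> {(i - 1) * k + 1..i * k} = {x}"
proof -
  let ?I = "\<lambda>i. {(i - 1) * k + 1..i * k}"
  have fin: "finite e" and card: "card e = d" and sub: "e \<subseteq> {1..k * d}"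
    using permutation_hypergraphD(2,3)[OF P e] by simp_all
  have le1: "card (e \<inter> ?I j) \<le> 1" if "j \<in> {1..d}" for j
    using permutation_hypergraphD(4)[OF P e that] fin by (auto simp: card_le_Suc0_iff_eq)
  have UN: "(\<Union>j\<in>{1..d}. ?I j) = {1..k * d}"
    using P by (simp add: permutation_hypergraph_def partite_with_def)
  have "d \<le> (\<Sum>j\<in>{1..d}. card (e \<inter> ?I j))"
  proof -
    have "e = (\<Union>j\<in>{1..d}. e \<inter> ?I j)" using UN sub by blast
    then have "card e \<le> (\<Sum>j\<in>{1..d}. card (e \<inter> ?I j))"
      using card_UN_le[of "{1..d}" "\<lambda>j. e \<inter> ?I j"] by simp
    then show ?thesis using card by simp
  qed
  also have "\<dots> = card (e \<inter> ?I i) + (\<Sum>j\<in>{1..d} - {i}. card (e \<inter> ?I j))"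
    using i by (simp add: sum.remove)
  also have "\<dots> \<le> card (e \<inter> ?I i) + (\<Sum>j\<in>{1..d} - {i}. 1)"
    by (intro add_left_mono sum_mono le1) auto
  also have "\<dots> = card (e \<inter> ?I i) + (d - 1)" using i by simp
  finally have "card (e \<inter> ?I i) = 1" using le1[OF i] i by auto
  then show ?thesis by (simp add: card_1_singleton_iff)
qed

text \<open>Vertices are shifted so that the permutation acts on \<open>{..<k}\<close>.\<close>

definition proj :: "nat \<Rightarrow> nat hypergraph \<Rightarrow> nat \<Rightarrow> nat" where
  "proj k P i = (if i < k then THE j. j < k \<and> (\<exists>e\<in>edges P. Suc i \<in> e \<and> Suc (k + j) \<in> e) else i)"

lemma proj_eqI:
  assumes P: "permutation_hypergraph d k P" and d: "d \<ge> 2"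
    and e: "e \<in> edges P" "Suc i \<in> e" "Suc (k + j) \<in> e" and ij: "i < k" "j < k"
  shows "proj k P i = j"
proof -
  have "k * 1 \<le> k * d" using d by (intro mult_le_mono2) simp
  then have i1: "Suc i \<in> {1..k * d}" using ij unfolding atLeastAtMost_iff by linarith
  have "j' = j" if "j' < k" "e' \<in> edges P" "Suc i \<in> e'" "Suc (k + j') \<in> e'" for e' j'
  proof -
    have "e' = e" using permutation_hypergraphD(5)[OF P i1] e that by blast
    then have "Suc (k + j') = Suc (k + j)"
      using permutation_hypergraphD(4)[OF P e(1), of 2 "Suc (k + j')" "Suc (k + j)"] e that ij d by simp
    then show ?thesis by simp
  qed
  then have "(THE j. j < k \<and> (\<exists>e\<in>edges P. Suc i \<in> e \<and> Suc (k + j) \<in> e)) = j"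
    using e ij by (intro the_equality) blast+
  then show ?thesis using ij by (simp add: proj_def)
qed

lemma proj_edge:
  assumes P: "permutation_hypergraph d k P" and d: "d \<ge> 2" and i: "i < k"
  shows "proj k P i < k" "\<exists>e\<in>edges P. Suc i \<in> e \<and> Suc (k + proj k P i) \<in> e"
proof -
  have "k * 1 \<le> k * d" using d by (intro mult_le_mono2) simp
  then have "Suc i \<in> {1..k * d}" using i unfolding atLeastAtMost_iff by linarith
  then obtain e where e: "e \<in> edges P" "Suc i \<in> e" using permutation_hypergraphD(5)[OF P] by blast
  obtain x where x: "e \<inter> {(2 - 1) * k + 1..2 * k} = {x}"
    using edge_meets_part[OF P e(1), of 2] d by auto
  then have x': "x \<in> e" "Suc k \<le> x" "x \<le> 2 * k" by auto
  then obtain j where j: "x = Suc (k + j)" using le_Suc_ex[of "Suc k" x] by auto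
  then have "j < k" using x' by simp
  then have "proj k P i = j" using proj_eqI[OF P d e _ i] x' j by simp
  then show "proj k P i < k" "\<exists>e\<in>edges P. Suc i \<in> e \<and> Suc (k + proj k P i) \<in> e"
    using \<open>j < k\<close> e x' j by auto
qed

lemma proj_permutes:
  assumes P: "permutation_hypergraph d k P" and d: "d \<ge> 2"
  shows "proj k P permutes {..<k}"
proof (rule bij_imp_permutes)
  have kd: "k * 2 \<le> k * d" using d by (intro mult_le_mono2)
  have "inj_on (proj k P) {..<k}"
  proof (rule inj_onI)
    fix i i' assume i: "i \<in> {..<k}" "i' \<in> {..<k}" "proj k P i = proj k P i'"
    obtain e e' where e: "e \<in> edges P" "Suc i \<in> e" "Suc (k + proj k P i) \<in> e"
      "e' \<in> edges P" "Suc i' \<in> e'" "Suc (k + proj k P i) \<in> e'"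
      using proj_edge(2)[OF P d, of i] proj_edge(2)[OF P d, of i'] i by auto
    have "Suc (k + proj k P i) \<in> {1..k * d}" using proj_edge(1)[OF P d, of i] i kd
      unfolding atLeastAtMost_iff lessThan_iff by linarith
    then have "e' = e" using permutation_hypergraphD(5)[OF P] e by blast
    then have "Suc i = Suc i'"
      using permutation_hypergraphD(4)[OF P e(1), of 1 "Suc i" "Suc i'"] e i d by simp
    then show "i = i'" by simp
  qed
  then show "bij_betw (proj k P) {..<k} {..<k}"
    using proj_edge(1)[OF P d] by (intro bij_betw_imageI endo_inj_surj) auto
\<comment> \<open>The default branch of \<open>proj\<close> fixes everything outside
  \<open>{..<k}\<close>, as \<open>permutes\<close> demands.\<close>
qed (simp add: proj_def)

section \<open>Relabelling the second part and the distribution of the projection\<close>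

definition relabel :: "nat \<Rightarrow> (nat \<Rightarrow> nat) \<Rightarrow> nat \<Rightarrow> nat" where
  "relabel k \<sigma> v = (if k < v \<and> v \<le> 2 * k then Suc (k + \<sigma> (v - Suc k)) else v)"

text \<open>Only the second part is moved, and within itself; hence relabelling respects
  partiteness.\<close>

lemma relabel_part:
  assumes \<sigma>: "\<sigma> permutes {..<k}" and i: "i \<ge> 1"
  shows "relabel k \<sigma> v \<in> {(i - 1) * k + 1..i * k} \<longleftrightarrow> v \<in> {(i - 1) * k + 1..i * k}"
proof (cases "k < v \<and> v \<le> 2 * k")
  case True
  define j where "j = v - Suc k"
  have j: "v = Suc (k + j)" "j < k" using True by (auto simp: j_def)
  have *: "Suc (k + a) \<in> {(i - 1) * k + 1..i * k} \<longleftrightarrow> i = 2" if "a < k" for a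
  proof -
    consider "i = 1" | "i = 2" | "i \<ge> 3" using i by linarith
    then show ?thesis
    proof cases
      case 3
      then have "2 * k \<le> (i - 1) * k" by (intro mult_le_mono1) simp
      then have "\<not> (i - 1) * k + 1 \<le> Suc (k + a)" using that by linarith
      then show ?thesis using 3 by auto
    qed (use that in auto)
  qed
  have "\<sigma> j < k" using permutes_in_image[OF \<sigma>, of j] j by simp
  moreover have "relabel k \<sigma> v = Suc (k + \<sigma> j)" using True by (simp add: relabel_def j_def)
  ultimately show ?thesis using *[of j] *[of "\<sigma> j"] j by simp
qed (auto simp: relabel_def)

lemma relabel_inverse:
  assumes \<sigma>: "\<sigma> permutes {..<k}"
  shows "relabel k (inv \<sigma>) (relabel k \<sigma> v) = v"
proof (cases "k < v \<and> v \<le> 2 * k")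
  case True
  define j where "j = v - Suc k"
  have j: "v = Suc (k + j)" "j < k" using True by (auto simp: j_def)
  have "\<sigma> j < k" using permutes_in_image[OF \<sigma>, of j] j by simp
  then show ?thesis using j permutes_inverses(2)[OF \<sigma>] by (simp add: relabel_def)
qed (auto simp: relabel_def)

lemma relabel_inj:
  assumes \<sigma>: "\<sigma> permutes {..<k}"
  shows "inj (relabel k \<sigma>)"
  using relabel_inverse[OF \<sigma>] by (rule inj_on_inverseI)

definition relabel_hypergraph :: "nat \<Rightarrow> (nat \<Rightarrow> nat) \<Rightarrow> nat hypergraph \<Rightarrow> nat hypergraph" where
  "relabel_hypergraph k \<sigma> P = (verts P, (\<lambda>e. relabel k \<sigma> ` e) ` edges P)"

lemma relabel_in_verts:
  assumes "d \<ge> 2" and \<sigma>: "\<sigma> permutes {..<k}"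
  shows "relabel k \<sigma> v \<in> {1..k * d} \<longleftrightarrow> v \<in> {1..k * d}"
proof (cases "k < v \<and> v \<le> 2 * k")
  case True
  have kd: "2 * k \<le> k * d" using mult_le_mono2[OF assms(1), of k] by simp
  have "v \<in> {(2 - 1) * k + 1..2 * k}" using True by simp
  then have "relabel k \<sigma> v \<in> {(2 - 1) * k + 1..2 * k}" using relabel_part[OF \<sigma>, of 2 v] by simp
  then have "1 \<le> relabel k \<sigma> v" "relabel k \<sigma> v \<le> k * d" "1 \<le> v" "v \<le> k * d"
    using True kd by (auto intro: le_trans)
  then show ?thesis by simp
qed (auto simp: relabel_def)

lemma relabel_permutation_hypergraph:
  assumes P: "permutation_hypergraph d k P" and d: "d \<ge> 2" and \<sigma>: "\<sigma> permutes {..<k}"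
  shows "permutation_hypergraph d k (relabel_hypergraph k \<sigma> P)"
proof -
  let ?r = "relabel k \<sigma>"
  have inj: "inj ?r" using \<sigma> by (rule relabel_inj)
  note D = permutation_hypergraphD[OF P]
  have E: "edges (relabel_hypergraph k \<sigma> P) = (\<lambda>e. ?r ` e) ` edges P"
    and V: "verts (relabel_hypergraph k \<sigma> P) = {1..k * d}"
    using D(1) by (simp_all add: relabel_hypergraph_def)
  have "ordered_hypergraph (relabel_hypergraph k \<sigma> P)"
    unfolding ordered_hypergraph_def E V using D(2) relabel_in_verts[OF d \<sigma>] by blast
  moreover have "uniform d (relabel_hypergraph k \<sigma> P)"
    unfolding uniform_def E using D(3) card_image[OF inj_on_subset[OF inj subset_UNIV]] by auto
  moreover have "partite_with d (\<lambda>i. {(i - 1) * k + 1..i * k}) (relabel_hypergraph k \<sigma> P)"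
    unfolding partite_with_def
  proof (intro conjI)
    show "\<forall>e\<in>edges (relabel_hypergraph k \<sigma> P). \<forall>i\<in>{1..d}. \<forall>x\<in>e \<inter> {(i - 1) * k + 1..i * k}.
        \<forall>y\<in>e \<inter> {(i - 1) * k + 1..i * k}. x = y"
    proof (intro ballI)
      fix e i x y assume *: "e \<in> edges (relabel_hypergraph k \<sigma> P)" "i \<in> {1..d}"
        "x \<in> e \<inter> {(i - 1) * k + 1..i * k}" "y \<in> e \<inter> {(i - 1) * k + 1..i * k}"
      then obtain e' x' y' where e': "e' \<in> edges P" "x' \<in> e'" "y' \<in> e'" "x = ?r x'" "y = ?r y'"
        unfolding E by blast
      have "i \<ge> 1" using *(2) by simp
      then have "x' = y'"
        using D(4)[OF e'(1) *(2) e'(2,3)] *(3,4) relabel_part[OF \<sigma>] e'(4,5) by blast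
      then show "x = y" using e' by simp
    qed
  next
    have part: "partite_with d (\<lambda>i. {(i - 1) * k + 1..i * k}) P"
      using P by (simp only: permutation_hypergraph_def)
    show "(\<Union>i\<in>{1..d}. {(i - 1) * k + 1..i * k}) = verts (relabel_hypergraph k \<sigma> P)"
      using part unfolding partite_with_def relabel_hypergraph_def fst_conv by (elim conjE)
    show "\<forall>i\<in>{1..d}. \<forall>j\<in>{1..d}. i < j \<longrightarrow>
        (\<forall>x\<in>{(i - 1) * k + 1..i * k}. \<forall>y\<in>{(j - 1) * k + 1..j * k}. x < y)"
      using part unfolding partite_with_def by (elim conjE)
  qed
  moreover have "\<forall>v\<in>{1..k * d}. \<exists>!e. e \<in> edges (relabel_hypergraph k \<sigma> P) \<and> v \<in> e"
  proof
    fix v assume v: "v \<in> {1..k * d}"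
    define u where "u = relabel k (inv \<sigma>) v"
    have v_eq: "v = ?r u"
      using relabel_inverse[OF permutes_inv[OF \<sigma>], of v] by (simp add: u_def permutes_inv_inv[OF \<sigma>])
    then have "u \<in> {1..k * d}" using v relabel_in_verts[OF d \<sigma>] by blast
    then obtain e where e: "e \<in> edges P" "u \<in> e" "\<And>e'. e' \<in> edges P \<Longrightarrow> u \<in> e' \<Longrightarrow> e' = e"
      using D(5) by blast
    show "\<exists>!e. e \<in> edges (relabel_hypergraph k \<sigma> P) \<and> v \<in> e"
    proof (rule ex1I[of _ "?r ` e"])
      fix e2 assume "e2 \<in> edges (relabel_hypergraph k \<sigma> P) \<and> v \<in> e2"
      then obtain e' where "e' \<in> edges P" "e2 = ?r ` e'" "?r u \<in> ?r ` e'" unfolding E v_eq by blast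
      then show "e2 = ?r ` e" using e(3)[of e'] by (simp add: inj_image_mem_iff[OF inj])
    next
      show "?r ` e \<in> edges (relabel_hypergraph k \<sigma> P) \<and> v \<in> ?r ` e"
        unfolding E v_eq using e(1,2) by blast
    qed
  qed
  ultimately show ?thesis using V by (simp add: permutation_hypergraph_def)
qed

lemma proj_relabel:
  assumes P: "permutation_hypergraph d k P" and d: "d \<ge> 2" and \<sigma>: "\<sigma> permutes {..<k}"
  shows "proj k (relabel_hypergraph k \<sigma> P) = \<sigma> \<circ> proj k P"
proof
  fix i
  show "proj k (relabel_hypergraph k \<sigma> P) i = (\<sigma> \<circ> proj k P) i"
  proof (cases "i < k")
    case True
    obtain e where e: "e \<in> edges P" "Suc i \<in> e" "Suc (k + proj k P i) \<in> e"
      using proj_edge(2)[OF P d True] by blast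
    have lt: "proj k P i < k" using proj_edge(1)[OF P d True] .
    then have lt2: "\<sigma> (proj k P i) < k" using permutes_in_image[OF \<sigma>, of "proj k P i"] by simp
    have "relabel k \<sigma> (Suc i) = Suc i" "relabel k \<sigma> (Suc (k + proj k P i)) = Suc (k + \<sigma> (proj k P i))"
      using True lt by (simp_all add: relabel_def)
    then have "Suc i \<in> relabel k \<sigma> ` e" "Suc (k + \<sigma> (proj k P i)) \<in> relabel k \<sigma> ` e"
      using e by (metis imageI)+
    moreover have "relabel k \<sigma> ` e \<in> edges (relabel_hypergraph k \<sigma> P)"
      using e(1) by (simp add: relabel_hypergraph_def)
    ultimately show ?thesis
      using proj_eqI[OF relabel_permutation_hypergraph[OF P d \<sigma>] d _ _ _ True lt2] by simp
  next
    case False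
    then show ?thesis using permutes_not_in[OF \<sigma>, of i] by (simp add: proj_def)
  qed
qed

lemma finite_permutation_hypergraphs: "finite {P. permutation_hypergraph d k P \<and> Q P}"
proof (rule finite_subset)
  show "{P. permutation_hypergraph d k P \<and> Q P} \<subseteq> {{1..k * d}} \<times> Pow (Pow {1..k * d})"
    using permutation_hypergraphD(1,2) by fastforce
qed auto

text \<open>Relabelling by \<open>\<rho>' \<circ> inv \<rho>\<close> maps one fibre injectively into
  the other, and conversely. Hence \<open>proj\<close> of a uniform hypergraph is a uniform
  permutation.\<close>

lemma card_fibre:
  assumes d: "d \<ge> 2" and \<rho>: "\<rho> permutes {..<k}" and \<rho>': "\<rho>' permutes {..<k}"
  shows "card {P. permutation_hypergraph d k P \<and> proj k P = \<rho>}
    = card {P. permutation_hypergraph d k P \<and> proj k P = \<rho>'}"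
proof -
  have le: "card {P. permutation_hypergraph d k P \<and> proj k P = \<rho>}
      \<le> card {P. permutation_hypergraph d k P \<and> proj k P = \<rho>'}"
    if \<rho>: "\<rho> permutes {..<k}" and \<rho>': "\<rho>' permutes {..<k}" for \<rho> \<rho>'
  proof (rule card_inj_on_le[of "relabel_hypergraph k (\<rho>' \<circ> inv \<rho>)"])
    let ?\<sigma> = "\<rho>' \<circ> inv \<rho>"
    have \<sigma>: "?\<sigma> permutes {..<k}" using \<rho> \<rho>' by (intro permutes_compose permutes_inv)
    have "inj (image (relabel k ?\<sigma>))"
      by (rule injI) (simp add: inj_image_eq_iff[OF relabel_inj[OF \<sigma>]])
    then show "inj_on (relabel_hypergraph k ?\<sigma>) {P. permutation_hypergraph d k P \<and> proj k P = \<rho>}"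
      by (intro inj_onI prod_eqI) (simp_all add: relabel_hypergraph_def inj_image_eq_iff)
    have "?\<sigma> \<circ> \<rho> = \<rho>'" using permutes_inv_o(2)[OF \<rho>] by (simp add: comp_assoc)
    then show "relabel_hypergraph k ?\<sigma> ` {P. permutation_hypergraph d k P \<and> proj k P = \<rho>}
        \<subseteq> {P. permutation_hypergraph d k P \<and> proj k P = \<rho>'}"
      using relabel_permutation_hypergraph[OF _ d \<sigma>] proj_relabel[OF _ d \<sigma>] by auto
  qed (rule finite_permutation_hypergraphs)
  show ?thesis using le[OF \<rho> \<rho>'] le[OF \<rho>' \<rho>] by (rule antisym)
qed

text \<open>Since the fibres have equal size, the proportion of hypergraphs whose projection
  satisfies \<open>Q\<close> is the proportion of permutations satisfying \<open>Q\<close>.\<close>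

lemma card_by_proj:
  assumes d: "d \<ge> 2"
  shows "card {P. permutation_hypergraph d k P \<and> Q (proj k P)}
    = card {P. permutation_hypergraph d k P \<and> proj k P = id} * card {\<pi>. \<pi> permutes {..<k} \<and> Q \<pi>}"
proof -
  let ?H = "\<lambda>\<rho>. {P. permutation_hypergraph d k P \<and> proj k P = \<rho>}"
  let ?Q = "{\<pi>. \<pi> permutes {..<k} \<and> Q \<pi>}"
  have fin: "finite ?Q" by (rule finite_subset[OF _ finite_permutations[of "{..<k}"]]) auto
  have "{P. permutation_hypergraph d k P \<and> Q (proj k P)} = (\<Union>\<pi>\<in>?Q. ?H \<pi>)"
    using proj_permutes[OF _ d] by auto
  also have "card \<dots> = (\<Sum>\<pi>\<in>?Q. card (?H \<pi>))"
    using fin by (intro card_UN_disjoint) (auto simp: finite_permutation_hypergraphs)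
  also have "\<dots> = (\<Sum>\<pi>\<in>?Q. card (?H id))"
    by (intro sum.cong[OF refl] card_fibre[OF d]) (auto simp: permutes_id)
  finally show ?thesis by simp
qed

text \<open>Keeps the denominator of the proportion positive. In the witness, edge
  \<open>e i\<close> collects the \<open>i\<close>-th vertex of every part.\<close>

lemma permutation_hypergraph_exists: "\<exists>P. permutation_hypergraph d k P"
proof -
  define e where "e i = (\<lambda>j. j * k + i) ` {..<d}" for i
  let ?P = "({1..k * d}, e ` {1..k})"
  have decomp: "i = i' \<and> j = j'" if *: "j * k + i = j' * k + i'" "i \<in> {1..k}" "i' \<in> {1..k}" for i i' j j' :: nat
  proof -
    \<comment> \<open>Shifting from \<open>{1..k}\<close> to residues below \<open>k\<close> lets
      \<open>div\<close> and \<open>mod\<close> separate the summands.\<close>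
    obtain a a' where a: "i = Suc a" "i' = Suc a'" "a < k" "a' < k"
      using *(2,3) by (cases i; cases i') auto
    have eq: "j * k + a = j' * k + a'" using *(1) a by simp
    have "j = (j * k + a) div k" "a = (j * k + a) mod k" using a by simp_all
    moreover have "j' = (j' * k + a') div k" "a' = (j' * k + a') mod k" using a by simp_all
    ultimately show ?thesis using eq a(1,2) by metis
  qed
  have bound: "j * k + i \<in> {1..k * d}" if "j < d" "i \<in> {1..k}" for i j
  proof -
    have "(j + 1) * k \<le> d * k" using that by (intro mult_le_mono1) simp
    then show ?thesis using that by (simp add: mult.commute)
  qed
  have rep: "\<exists>j<d. \<exists>i\<in>{1..k}. v = j * k + i" if "v \<in> {1..k * d}" for v
  proof (intro exI[of _ "(v - 1) div k"] conjI bexI[of _ "(v - 1) mod k + 1"])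
    have k: "k > 0" using that by (cases k) auto
    have "v - 1 < d * k" using that by (auto simp: mult.commute)
    then show "(v - 1) div k < d" using k by (simp add: div_less_iff_less_mult)
    show "v = (v - 1) div k * k + ((v - 1) mod k + 1)" using that div_mult_mod_eq[of "v - 1" k] by simp
    show "(v - 1) mod k + 1 \<in> {1..k}" using k by (simp add: Suc_le_eq)
  qed
  have part: "j * k + i \<in> {(p - 1) * k + 1..p * k} \<longleftrightarrow> p = Suc j" if "i \<in> {1..k}" "p \<ge> 1" for i j p
  proof
    assume *: "j * k + i \<in> {(p - 1) * k + 1..p * k}"
    define i' where "i' = j * k + i - (p - 1) * k"
    have "p * k = (p - 1) * k + k" using that by (cases p) auto
    then have "i' \<in> {1..k}" "j * k + i = (p - 1) * k + i'" using * by (auto simp: i'_def)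
    then show "p = Suc j" using decomp[of j i "p - 1" i'] that by simp
  qed (use that in auto)
  have "ordered_hypergraph ?P" using bound by (auto simp: ordered_hypergraph_def e_def)
  moreover have "uniform d ?P"
    by (auto simp: uniform_def e_def card_image inj_on_def)
  moreover have "partite_with d (\<lambda>i. {(i - 1) * k + 1..i * k}) ?P"
    unfolding partite_with_def
  proof (intro conjI)
    show "(\<Union>i\<in>{1..d}. {(i - 1) * k + 1..i * k}) = verts ?P"
    proof (intro equalityI subsetI)
      fix v assume "v \<in> (\<Union>i\<in>{1..d}. {(i - 1) * k + 1..i * k})"
      then obtain i where i: "i \<le> d" "(i - 1) * k + 1 \<le> v" "v \<le> i * k" by auto
      have "i * k \<le> d * k" using i by (intro mult_le_mono1)
      then have "v \<le> d * k" using i by linarith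
      then show "v \<in> verts ?P" using i by (simp add: mult.commute)
    next
      fix v assume "v \<in> verts ?P"
      then obtain j i where ji: "j < d" "i \<in> {1..k}" "v = j * k + i" using rep[of v] by auto
      then show "v \<in> (\<Union>i\<in>{1..d}. {(i - 1) * k + 1..i * k})"
        by (intro UN_I[of "Suc j"]) (use part[of i "Suc j" j] in auto)
    qed
    show "\<forall>i\<in>{1..d}. \<forall>j\<in>{1..d}. i < j \<longrightarrow>
        (\<forall>x\<in>{(i - 1) * k + 1..i * k}. \<forall>y\<in>{(j - 1) * k + 1..j * k}. x < y)"
    proof (intro ballI impI)
      fix i j x y assume *: "i \<in> {1..d}" "j \<in> {1..d}" "i < j"
        "x \<in> {(i - 1) * k + 1..i * k}" "y \<in> {(j - 1) * k + 1..j * k}"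
      have "i * k \<le> (j - 1) * k" using * by (intro mult_le_mono1) simp
      then show "x < y" using *(4,5) unfolding atLeastAtMost_iff by linarith
    qed
    show "\<forall>a\<in>edges ?P. \<forall>p\<in>{1..d}. \<forall>x\<in>a \<inter> {(p - 1) * k + 1..p * k}.
        \<forall>y\<in>a \<inter> {(p - 1) * k + 1..p * k}. x = y"
    proof (intro ballI)
      fix a p x y assume *: "a \<in> edges ?P" "p \<in> {1..d}" "x \<in> a \<inter> {(p - 1) * k + 1..p * k}"
        "y \<in> a \<inter> {(p - 1) * k + 1..p * k}"
      obtain i where i: "i \<in> {1..k}" "a = e i" using *(1) by auto
      obtain j j' where "x = j * k + i" "y = j' * k + i" using * i by (auto simp: e_def)
      moreover have "p \<ge> 1" using * by simp
      ultimately show "x = y" using * part[OF i(1)] by (metis IntD2 Suc_inject)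
    qed
  qed
  moreover have "\<forall>v\<in>{1..k * d}. \<exists>!a. a \<in> edges ?P \<and> v \<in> a"
  proof
    fix v assume "v \<in> {1..k * d}"
    then obtain j i where ji: "j < d" "i \<in> {1..k}" "v = j * k + i" using rep by blast
    show "\<exists>!a. a \<in> edges ?P \<and> v \<in> a"
    proof (rule ex1I[of _ "e i"])
      fix a assume "a \<in> edges ?P \<and> v \<in> a"
      then obtain i' j' where "i' \<in> {1..k}" "a = e i'" "v = j' * k + i'" by (auto simp: e_def)
      then show "a = e i" using decomp[of j i j' i'] ji by simp
    qed (use ji in \<open>auto simp: e_def\<close>)
  qed
  ultimately have "permutation_hypergraph d k ?P" by (simp add: permutation_hypergraph_def)
  then show ?thesis ..
qed

text \<open>Vertices up to \<open>m\<close> stand for rows, the next \<open>m\<close> for columns,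
  and the set \<open>Z\<close> lies after both. The choice of \<open>Z\<close> supplies
  \<open>d - 2\<close> of the \<open>d - 1\<close> factors \<open>n\<close>.\<close>

definition host_edges :: "nat \<Rightarrow> nat \<Rightarrow> nat \<Rightarrow> (nat \<times> nat) set \<Rightarrow> nat set set" where
  "host_edges d n m R = (\<lambda>((a, b), Z). insert (Suc a) (insert (Suc (m + b)) Z)) `
     (R \<times> {Z. Z \<subseteq> {2 * m + 1..n} \<and> card Z = d - 2})"

lemma card_host_edge:
  assumes "d \<ge> 2" "R \<subseteq> {..<m} \<times> {..<m}" "e \<in> host_edges d n m R"
  shows "card e = d" "finite e"
proof -
  obtain a b Z where e: "(a, b) \<in> R" "Z \<subseteq> {2 * m + 1..n}" "card Z = d - 2"
    "e = insert (Suc a) (insert (Suc (m + b)) Z)"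
    using assms(3) by (auto simp: host_edges_def)
  have Z: "finite Z" using e(2) finite_subset by blast
  have "a < m" "b < m" using e(1) assms(2) by auto
  then have "Suc a \<notin> insert (Suc (m + b)) Z" "Suc (m + b) \<notin> Z" using e(2) by auto
  then show "card e = d" "finite e" using Z e(3,4) assms(1) by simp_all
qed

text \<open>Cutting an edge at \<open>m\<close> and \<open>2 * m\<close> recovers the entry and
  \<open>Z\<close>.\<close>

lemma card_host_edges:
  assumes R: "R \<subseteq> {..<m} \<times> {..<m}"
  shows "card (host_edges d n m R) = card R * ((n - 2 * m) choose (d - 2))"
proof -
  let ?Zs = "{Z. Z \<subseteq> {2 * m + 1..n} \<and> card Z = d - 2}"
  have "inj_on (\<lambda>((a, b), Z). insert (Suc a) (insert (Suc (m + b)) Z)) (R \<times> ?Zs)"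
  proof (rule inj_onI)
    fix p p' assume p: "p \<in> R \<times> ?Zs" "p' \<in> R \<times> ?Zs"
      "(\<lambda>((a, b), Z). insert (Suc a) (insert (Suc (m + b)) Z)) p =
       (\<lambda>((a, b), Z). insert (Suc a) (insert (Suc (m + b)) Z)) p'"
    obtain a b Z where 1: "p = ((a, b), Z)" by (metis prod.exhaust)
    obtain a' b' Z' where 2: "p' = ((a', b'), Z')" by (metis prod.exhaust)
    have ab: "(a, b) \<in> R" "(a', b') \<in> R" and Z: "Z \<subseteq> {2 * m + 1..n}" "Z' \<subseteq> {2 * m + 1..n}"
      and eq: "insert (Suc a) (insert (Suc (m + b)) Z) = insert (Suc a') (insert (Suc (m + b')) Z')"
      using p unfolding 1 2 by auto
    let ?e = "insert (Suc a) (insert (Suc (m + b)) Z)" and ?e' = "insert (Suc a') (insert (Suc (m + b')) Z')"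
    have lt: "a < m" "b < m" "a' < m" "b' < m" using ab R by auto
    have "?e \<inter> {..m} = {Suc a}" "?e' \<inter> {..m} = {Suc a'}" using lt Z by auto
    moreover have "?e \<inter> {m<..2 * m} = {Suc (m + b)}" "?e' \<inter> {m<..2 * m} = {Suc (m + b')}"
      using lt Z by auto
    moreover have "?e \<inter> {2 * m<..} = Z" "?e' \<inter> {2 * m<..} = Z'" using lt Z by auto
    ultimately have "{Suc a} = {Suc a'}" "{Suc (m + b)} = {Suc (m + b')}" "Z = Z'"
      using eq by metis+
    then show "p = p'" by (simp add: 1 2)
  qed
  then have "card (host_edges d n m R) = card R * card ?Zs"
    unfolding host_edges_def by (simp add: card_image card_cartesian_product)
  also have "card ?Zs = (n - 2 * m) choose (d - 2)"
    using n_subsets[of "{2 * m + 1..n}" "d - 2"] by simp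
  finally show ?thesis .
qed

text \<open>Both hypergraphs have edges of size \<open>d\<close>, so an edge is mapped onto its
  image edge. Monotonicity takes the two smallest vertices, which code a point of
  \<open>proj k P\<close>, to the two smallest vertices of the image, which code an entry of
  \<open>R\<close>.\<close>

lemma host_contains_imp_occurs:
  assumes P: "permutation_hypergraph d k P" and d: "d \<ge> 2" and R: "R \<subseteq> {..<m} \<times> {..<m}"
    and cont: "contains ({1..n}, host_edges d n m R) P"
  shows "occurs (proj k P) k R"
proof -
  note D = permutation_hypergraphD[OF P]
  have kd: "2 * k \<le> k * d" using mult_le_mono2[OF d, of k] by simp
  have in_verts: "v \<in> {1..k * d}" if "1 \<le> v" "v \<le> 2 * k" for v
    using that kd unfolding atLeastAtMost_iff by linarith
  obtain f g where f: "strict_mono_on {1..k * d} f" and g: "g ` edges P \<subseteq> host_edges d n m R"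
    and fg: "\<And>e. e \<in> edges P \<Longrightarrow> f ` e \<subseteq> g e"
    using cont D(1) unfolding contains_def by auto
  have inj: "inj_on f {1..k * d}" using f by (rule strict_mono_on_imp_inj_on)
  have eq: "f ` e = g e" if "e \<in> edges P" for e
  proof (rule card_subset_eq[OF _ fg[OF that]])
    have "g e \<in> host_edges d n m R" using g that by blast
    then show "finite (g e)" "card (f ` e) = card (g e)"
      using card_host_edge[OF d R] D(3)[OF that] card_image[OF inj_on_subset[OF inj D(2)[OF that]]]
      by simp_all
  qed
  have key: "\<exists>a b. (a, b) \<in> R \<and> f (Suc i) = Suc a \<and> f (Suc (k + proj k P i)) = Suc (m + b)"
    if i: "i < k" for i
  proof -
    define j where "j = proj k P i"
    obtain e where e: "e \<in> edges P" "Suc i \<in> e" "Suc (k + j) \<in> e" and j: "j < k"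
      using proj_edge[OF P d i] unfolding j_def by blast
    have le: "f u \<le> f v" if "u \<in> e" "v \<in> e" "u \<le> v" for u v
      using strict_mono_on_leD[OF f, of u v] D(2)[OF e(1)] that by blast
    \<comment> \<open>Each of the first two parts holds one vertex of \<open>e\<close>, so
      \<open>Suc i\<close> and \<open>Suc (k + j)\<close> are its two smallest.\<close>
    have large: "v = Suc i \<or> v = Suc (k + j) \<or> 2 * k < v" if v: "v \<in> e" for v
    proof -
      have "v = Suc i" if "v \<le> k"
        using D(4)[OF e(1), of 1 v "Suc i"] D(2)[OF e(1)] v e(2) i d that by auto
      moreover have "v = Suc (k + j)" if "k < v" "v \<le> 2 * k"
        using D(4)[OF e(1), of 2 v "Suc (k + j)"] v e(3) j d that by simp
      ultimately show ?thesis by linarith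
    qed
    have "g e \<in> host_edges d n m R" using g e(1) by blast
    then obtain a b Z where ab: "(a, b) \<in> R" and Z: "Z \<subseteq> {2 * m + 1..n}"
      and ge: "f ` e = insert (Suc a) (insert (Suc (m + b)) Z)"
      unfolding eq[OF e(1), symmetric] by (auto simp: host_edges_def)
    have lt: "a < m" "b < m" using ab R by auto
    obtain u where u: "u \<in> e" "f u = Suc a" using ge by (metis imageE insertI1)
    obtain v where v: "v \<in> e" "f v = Suc (m + b)" using ge by (metis imageE insertI1 insert_commute)
    have "f (Suc i) \<le> f u" using large[OF u(1)] i by (intro le e u) auto
    moreover have "f (Suc i) \<in> insert (Suc a) (insert (Suc (m + b)) Z)" using ge e(2) by blast
    ultimately have 1: "f (Suc i) = Suc a" using u(2) lt Z by auto
    have "v \<noteq> Suc i" using 1 v(2) lt by auto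
    then have "f (Suc (k + j)) \<le> f v" using large[OF v(1)] j by (intro le e v) auto
    moreover have "f (Suc (k + j)) \<in> insert (Suc a) (insert (Suc (m + b)) Z)" using ge e(3) by blast
    moreover have "f (Suc (k + j)) \<noteq> f (Suc i)"
      using inj_onD[OF inj, of "Suc (k + j)" "Suc i"] D(2)[OF e(1)] e(2,3) i by auto
    ultimately have 2: "f (Suc (k + j)) = Suc (m + b)" using v(2) 1 lt Z by auto
    show ?thesis using ab 1 2 unfolding j_def by blast
  qed
  have surj: "\<exists>i<k. proj k P i = j" if "j < k" for j
    using permutes_image[OF proj_permutes[OF P d]] that by (metis imageE lessThan_iff)
  show ?thesis
    unfolding occurs_def
  proof (intro exI conjI allI impI)
    show "strict_mono_on {..<k} (\<lambda>i. f (Suc i) - 1)"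
    proof (rule strict_mono_onI)
      fix i i' assume *: "i \<in> {..<k}" "i' \<in> {..<k}" "i < i'"
      have "f (Suc i) < f (Suc i')"
        using * by (intro strict_mono_onD[OF f] in_verts) auto
      then show "f (Suc i) - 1 < f (Suc i') - 1" using key[of i] * by auto
    qed
    show "strict_mono_on {..<k} (\<lambda>j. f (Suc (k + j)) - (m + 1))"
    proof (rule strict_mono_onI)
      fix j j' assume *: "j \<in> {..<k}" "j' \<in> {..<k}" "j < j'"
      have "f (Suc (k + j)) < f (Suc (k + j'))"
        using * by (intro strict_mono_onD[OF f] in_verts) auto
      \<comment> \<open>This keeps the truncated subtraction strict; \<open>key\<close> applies
        because \<open>j\<close> is a value of the projection.\<close>
      moreover have "m + 1 \<le> f (Suc (k + j))" using surj[of j] key * by fastforce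
      ultimately show "f (Suc (k + j)) - (m + 1) < f (Suc (k + j')) - (m + 1)" by linarith
    qed
    fix i assume "i < k"
    then show "(f (Suc i) - 1, f (Suc (k + proj k P i)) - (m + 1)) \<in> R" using key by force
  qed
qed

section \<open>Lower bounds for the extremal function\<close>

lemma ex_i_ge:
  assumes "ordered_hypergraph A" "verts A = {1..n}" "avoids A H"
  shows "weight A \<le> ex_i H n"
  unfolding ex_i_def
proof (rule Max_ge)
  let ?W = "{weight A | A :: nat hypergraph. ordered_hypergraph A \<and> verts A = {1..n} \<and> avoids A H}"
  have "?W \<subseteq> weight ` ({{1..n}} \<times> Pow (Pow {1..n}))"
    unfolding ordered_hypergraph_def by fastforce
  then show "finite ?W" by (rule finite_subset) auto
qed (use assms in blast)

lemma ex_i_ge_matrix: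
  assumes P: "permutation_hypergraph d k P" and d: "d \<ge> 2" and m: "2 * m \<le> n"
    and R: "R \<subseteq> {..<m} \<times> {..<m}" and av: "\<not> occurs (proj k P) k R"
  shows "card R * ((n - 2 * m) choose (d - 2)) \<le> ex_i P n"
proof -
  let ?A = "({1..n}, host_edges d n m R)"
  have "e \<subseteq> {1..n}" if "e \<in> host_edges d n m R" for e
    using that R m by (fastforce simp: host_edges_def)
  then have "ordered_hypergraph ?A" by (auto simp: ordered_hypergraph_def)
  moreover have "avoids ?A P" using host_contains_imp_occurs[OF P d R] av by blast
  ultimately have "weight ?A \<le> ex_i P n" by (intro ex_i_ge) auto
  moreover have "weight ?A = card (host_edges d n m R) * d"
    using card_host_edge(1)[OF d R] by (simp add: weight_def)
  \<comment> \<open>The weight is \<open>d\<close> times the number of edges; the factor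
    \<open>d\<close> is given away.\<close>
  moreover have "card (host_edges d n m R) * 1 \<le> card (host_edges d n m R) * d"
    using d by (intro mult_le_mono2) simp
  ultimately have "card (host_edges d n m R) \<le> ex_i P n" by linarith
  then show ?thesis by (simp only: card_host_edges[OF R])
qed

text \<open>Use \<open>B\<close>, roughly \<open>n / (4 * N)\<close>, copies of a matrix of side
  \<open>N = 2 ^ (4 * t)\<close>. Together they have at least \<open>B * 2 ^ (6 * t)\<close>
  entries, of order \<open>n * 2 ^ (2 * t)\<close>, and each extends to at least
  \<open>(n / (2 * d)) ^ (d - 2)\<close> edges.\<close>

lemma eventually_ex_i_ge:
  assumes P: "permutation_hypergraph d k P" and d: "d \<ge> 2" and t: "t \<ge> 1"
    and k: "4 * (8192 * t) * (8192 * t) \<le> k" and spread: "spread t k (proj k P)"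
  shows "\<forall>\<^sub>F n in sequentially.
    2 ^ (2 * t) / 8 * (1 / (2 * real d)) ^ (d - 2) * real n ^ (d - 1) \<le> real (ex_i P n)"
\<comment> \<open>The first summand pays for rounding in \<open>m\<close> and \<open>B\<close>; the
  second ensures \<open>d - 2 \<le> n - 2 * m\<close> for the binomial bound.\<close>
proof (rule eventually_sequentiallyI[of "16 * 2 ^ (4 * t) + 2 * d"])
  fix n :: nat assume n: "16 * 2 ^ (4 * t) + 2 * d \<le> n"
  define N :: nat where "N = 2 ^ (4 * t)"
  \<comment> \<open>Rows and columns together use at most half of the vertices and leave the other
    half for \<open>Z\<close>.\<close>
  define m where "m = n div 4"
  define B where "B = m div N"
  define l where "l = 8192 * t"
  have N1: "N \<ge> 1" by (simp add: N_def)
  have l1: "1 \<le> l" using t by (simp add: l_def)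
  have lk: "l \<le> k"
  proof -
    have "l * 1 \<le> l * (4 * l)" using l1 by (intro mult_le_mono2) simp
    also have "\<dots> = 4 * (8192 * t) * (8192 * t)" by (simp add: l_def)
    finally show ?thesis using k by simp
  qed
  obtain R where R: "R \<subseteq> {..<B * N} \<times> {..<B * N}" "B * 2 ^ (6 * t) \<le> card R"
    "\<not> occurs (proj k P) k R"
  proof (rule dense_avoiding_matrix[OF t l_def _ _ proj_permutes[OF P d], of "k div l" B])
    show "k div l \<ge> 1" using lk l1 by (simp add: Suc_le_eq div_greater_zero_iff)
    show "l * (k div l) \<le> k" by simp
  qed (use spread in \<open>auto simp: spread_def l_def N_def\<close>)
  have "B * N \<le> m" by (simp add: B_def)
  then have "R \<subseteq> {..<m} \<times> {..<m}" using R(1) by fastforce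
  then have ex: "card R * ((n - 2 * m) choose (d - 2)) \<le> ex_i P n"
    by (intro ex_i_ge_matrix[OF P d _ _ R(3)]) (simp_all add: m_def)
  have B: "real n / (8 * real N) \<le> real B"
  proof -
    have "n \<le> 4 * m + 3" by (simp add: m_def)
    moreover have "m < (B + 1) * N"
      using mod_less_divisor[of N m] div_mult_mod_eq[of m N] N1
      unfolding B_def distrib_right by linarith
    ultimately have "n \<le> 4 * ((B + 1) * N)" by linarith
    also have "\<dots> = 4 * (B * N) + 4 * N" by simp
    finally have "2 * n \<le> 8 * (B * N) + 8 * N" by linarith
    moreover have "8 * N \<le> n" using n by (simp add: N_def)
    ultimately have "n \<le> B * (8 * N)" by linarith
    then have "real n \<le> real B * (8 * real N)"
      using of_nat_mono[of n "B * (8 * N)", where ?'a = real] by simp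
    then show ?thesis using N1 by (simp add: divide_le_eq)
  qed
  have choose: "(real n / (2 * real d)) ^ (d - 2) \<le> real ((n - 2 * m) choose (d - 2))"
  \<comment> \<open>For \<open>d = 2\<close> both sides are 1; otherwise \<open>d - 2\<close> is a
    positive denominator.\<close>
  proof (cases "d = 2")
    case False
    have half: "n \<le> 2 * (n - 2 * m)" by (simp add: m_def)
    have "(real n / (2 * real d)) ^ (d - 2) \<le> (real (n - 2 * m) / real (d - 2)) ^ (d - 2)"
    proof (rule power_mono)
      have "real n / (2 * real d) = (real n / 2) / real d" by simp
      also have "\<dots> \<le> real (n - 2 * m) / real (d - 2)"
        using half False d by (intro frac_le) (simp_all add: m_def)
      finally show "real n / (2 * real d) \<le> real (n - 2 * m) / real (d - 2)" .
    qed simp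
    also have "\<dots> \<le> real ((n - 2 * m) choose (d - 2))"
      by (rule binomial_ge_n_over_k_pow_k) (use n half in linarith)
    finally show ?thesis .
  qed simp
  have "2 ^ (2 * t) / 8 * (1 / (2 * real d)) ^ (d - 2) * real n ^ (d - 1)
      = real n / (8 * real N) * 2 ^ (6 * t) * (real n / (2 * real d)) ^ (d - 2)"
  proof -
    have "real n ^ (d - 1) = real n * real n ^ (d - 2)"
      using d by (metis One_nat_def Suc_diff_Suc Suc_1 Suc_le_lessD power_Suc)
    moreover have "(2::real) ^ (6 * t) = 2 ^ (2 * t) * real N" by (simp add: N_def flip: power_add)
    ultimately show ?thesis using N1 by (simp add: power_divide field_simps)
  qed
  also have "\<dots> \<le> real B * 2 ^ (6 * t) * real ((n - 2 * m) choose (d - 2))"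
    using B choose by (intro mult_mono) auto
  also have "\<dots> \<le> real (card R) * real ((n - 2 * m) choose (d - 2))"
    using of_nat_mono[OF R(2), where ?'a = real] by (intro mult_right_mono) auto
  also have "\<dots> \<le> real (ex_i P n)"
    using of_nat_mono[OF ex, where ?'a = real] by simp
  finally show "2 ^ (2 * t) / 8 * (1 / (2 * real d)) ^ (d - 2) * real n ^ (d - 1) \<le> real (ex_i P n)" .
qed

section \<open>Convergence of the proportion\<close>

theorem corollary4p4:
  fixes d :: nat
  assumes "d \<ge> 2"
  shows "\<exists>c::real. c > 0 \<and>
    (\<lambda>k. real (card {P. permutation_hypergraph d k P \<and>
              (\<forall>\<^sub>F n in sequentially.
                 real (ex_i P n) \<ge> 2 powr (c * real k powr (1/2)) * real n ^ (d - 1))})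
         / real (card {P. permutation_hypergraph d k P}))
      \<longlonglongrightarrow> 1"
proof (intro exI conjI)
  \<comment> \<open>As \<open>16384\<^sup>2 = 4 * 8192\<^sup>2\<close>, the choice
    \<open>t = T k\<close>, which is \<open>c * sqrt k\<close> rounded down, satisfies
    \<open>4 * (8192 * t) * (8192 * t) \<le> k\<close>.\<close>
  define c :: real where "c = 1 / 16384"
  show "c > 0" by (simp add: c_def)
  define good where "good k P \<longleftrightarrow> (\<forall>\<^sub>F n in sequentially.
      real (ex_i P n) \<ge> 2 powr (c * real k powr (1/2)) * real n ^ (d - 1))" for k :: nat and P :: "nat hypergraph"
  define T where "T k = nat \<lfloor>c * sqrt (real k)\<rfloor>" for k :: nat
  have T_le: "real (T k) \<le> c * sqrt (real k)" and T_ge: "c * sqrt (real k) - 1 \<le> real (T k)" for k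
    by (simp_all add: T_def c_def) linarith
  have T_top: "filterlim T at_top sequentially"
    unfolding filterlim_at_top
  proof
    fix Z
    show "\<forall>\<^sub>F k in sequentially. Z \<le> T k"
    proof (rule eventually_sequentiallyI[of "(16384 * Z)\<^sup>2"])
      fix k assume "(16384 * Z)\<^sup>2 \<le> k"
      then have "(16384 * real Z)\<^sup>2 \<le> real k"
        using of_nat_mono[of "(16384 * Z)\<^sup>2" k, where ?'a = real] by simp
      then have "16384 * real Z \<le> sqrt (real k)" by (rule real_le_rsqrt)
      then show "Z \<le> T k" by (simp add: T_def c_def le_nat_iff le_floor_iff)
    qed
  qed
  have T_sq: "4 * (8192 * T k) * (8192 * T k) \<le> k" for k
  proof -
    have "16384 * real (T k) \<le> sqrt (real k)" using T_le[of k] by (simp add: c_def)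
    then have "(16384 * real (T k))\<^sup>2 \<le> (sqrt (real k))\<^sup>2" by (intro power_mono) auto
    then have "real ((16384 * T k)\<^sup>2) \<le> real k" by simp
    then have "(16384 * T k)\<^sup>2 \<le> k" unfolding of_nat_le_iff .
    then show ?thesis by (simp add: power2_eq_square)
  qed
  \<comment> \<open>Up to rounding, \<open>2 ^ (2 * T k)\<close> is the square of the wanted
    \<open>2 powr (c * sqrt k)\<close>. The spare factor is unbounded and absorbs the constants
    depending on \<open>d\<close>.\<close>
  have dense: "\<forall>\<^sub>F k in sequentially. 2 powr (c * real k powr (1/2)) \<le> 2 ^ (2 * T k) / 8 * (1 / (2 * real d)) ^ (d - 2)"
  proof -
    \<comment> \<open>The 32 combines the denominator 8 with the factor 4 lost by rounding in
      \<open>T\<close>.\<close>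
    define D where "D = 32 * (2 * real d) ^ (d - 2)"
    have D: "D > 0" using assms by (simp add: D_def)
    have "\<forall>\<^sub>F k in sequentially. nat \<lceil>D\<rceil> \<le> T k"
      using T_top unfolding filterlim_at_top by blast
    then show ?thesis
    proof eventually_elim
      case (elim k)
      have "D \<le> real (T k)" using elim by linarith
      also have "\<dots> \<le> 2 ^ T k" using of_nat_less_two_power[of "T k", where ?'a = real] by simp
      also have "\<dots> = 2 powr real (T k)" by (simp add: powr_realpow)
      also have "\<dots> \<le> 2 powr (c * sqrt (real k))" using T_le by simp
      finally have D_le: "D \<le> 2 powr (c * sqrt (real k))" .
      have "2 powr (c * sqrt (real k)) * D \<le> 2 powr (c * sqrt (real k)) * 2 powr (c * sqrt (real k))"
        using D_le by (intro mult_left_mono) auto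
      also have "\<dots> = 2 powr (2 * (c * sqrt (real k) - 1)) * 4"
        by (simp add: powr_diff powr_add[symmetric] algebra_simps)
      also have "2 powr (2 * (c * sqrt (real k) - 1)) \<le> 2 powr (real (2 * T k))"
        using T_ge[of k] by simp
      also have "2 powr (real (2 * T k)) = (2::real) ^ (2 * T k)" by (rule powr_realpow) simp
      finally have "2 powr (c * sqrt (real k)) * D \<le> 2 ^ (2 * T k) * 4" by simp
      then have "2 powr (c * sqrt (real k)) * (2 * real d) ^ (d - 2) \<le> 2 ^ (2 * T k) / 8"
        by (simp add: D_def mult_ac power_mult_distrib)
      moreover have "(2 * real d) ^ (d - 2) > 0" using assms by simp
      ultimately have "2 powr (c * sqrt (real k)) \<le> 2 ^ (2 * T k) / 8 / (2 * real d) ^ (d - 2)"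
        by (simp only: pos_le_divide_eq)
      also have "\<dots> = 2 ^ (2 * T k) / 8 * (1 / (2 * real d)) ^ (d - 2)"
        by (simp only: power_one_over times_divide_eq_right mult_1_right)
      finally show ?case by (simp add: powr_half_sqrt)
    qed
  qed
  let ?ratio = "\<lambda>k. real (card {P. permutation_hypergraph d k P \<and> good k P}) / real (card {P. permutation_hypergraph d k P})"
  have T1: "\<forall>\<^sub>F k in sequentially. 1 \<le> T k" using T_top by (simp add: filterlim_at_top)
  \<comment> \<open>Permutations that are not \<open>spread\<close> make up at most this fraction,
    and equal fibres transfer it to hypergraphs.\<close>
  have lower: "\<forall>\<^sub>F k in sequentially. 1 - 2 * (1/4) ^ T k \<le> ?ratio k"
    using dense T1
  proof eventually_elim
    case (elim k)
    define F where "F = card {P. permutation_hypergraph d k P \<and> proj k P = id}"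
    have all: "card {P. permutation_hypergraph d k P} = F * fact k"
      using card_by_proj[OF assms, of k "\<lambda>_. True"] by (simp add: F_def card_permutations)
    have "card {P. permutation_hypergraph d k P} > 0"
      using permutation_hypergraph_exists[of d k] finite_permutation_hypergraphs[of d k "\<lambda>_. True"]
      by (auto simp: card_gt_0_iff)
    then have F: "F > 0" using all by simp
    have fin: "finite {\<pi>. \<pi> permutes {..<k} \<and> Q \<pi>}" for Q
      by (rule finite_subset[OF _ finite_permutations[of "{..<k}"]]) auto
    have "(fact k :: nat) = card ({\<pi>. \<pi> permutes {..<k} \<and> spread (T k) k \<pi>} \<union> {\<pi>. \<pi> permutes {..<k} \<and> \<not> spread (T k) k \<pi>})"
      using card_permutations[of "{..<k}" k] by (simp add: Collect_disj_eq[symmetric] conj_disj_distribL[symmetric])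
    also have "\<dots> = card {\<pi>. \<pi> permutes {..<k} \<and> spread (T k) k \<pi>} + card {\<pi>. \<pi> permutes {..<k} \<and> \<not> spread (T k) k \<pi>}"
      by (intro card_Un_disjoint fin) auto
    finally have "real (fact k) = real (card {\<pi>. \<pi> permutes {..<k} \<and> spread (T k) k \<pi>})
        + real (card {\<pi>. \<pi> permutes {..<k} \<and> \<not> spread (T k) k \<pi>})"
      by (metis of_nat_add)
    then have "fact k * (1 - 2 * (1/4) ^ T k) \<le> real (card {\<pi>. \<pi> permutes {..<k} \<and> spread (T k) k \<pi>})"
      using card_not_spread[OF elim(2) T_sq] by (simp add: algebra_simps)
    then have "real F * (fact k * (1 - 2 * (1/4) ^ T k))
        \<le> real F * real (card {\<pi>. \<pi> permutes {..<k} \<and> spread (T k) k \<pi>})"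
      by (intro mult_left_mono) auto
    also have "\<dots> = real (card {P. permutation_hypergraph d k P \<and> spread (T k) k (proj k P)})"
      using card_by_proj[OF assms, of k "spread (T k) k"] by (simp add: F_def)
    also have "\<dots> \<le> real (card {P. permutation_hypergraph d k P \<and> good k P})"
    proof -
      have "good k P" if P: "permutation_hypergraph d k P" "spread (T k) k (proj k P)" for P
        unfolding good_def using eventually_ex_i_ge[OF P(1) assms elim(2) T_sq P(2)]
      proof eventually_elim
        case (elim n)
        have "2 powr (c * real k powr (1/2)) * real n ^ (d - 1)
            \<le> 2 ^ (2 * T k) / 8 * (1 / (2 * real d)) ^ (d - 2) * real n ^ (d - 1)"
          using \<open>2 powr (c * real k powr (1/2)) \<le> _\<close> by (intro mult_right_mono) auto
        with elim show ?case by linarith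
      qed
      then have "{P. permutation_hypergraph d k P \<and> spread (T k) k (proj k P)}
          \<subseteq> {P. permutation_hypergraph d k P \<and> good k P}" by blast
      then show ?thesis by (intro of_nat_mono card_mono finite_permutation_hypergraphs)
    qed
    finally show ?case using F by (simp add: all le_divide_eq mult_ac)
  qed
  have upper: "\<forall>\<^sub>F k in sequentially. ?ratio k \<le> 1"
  proof (rule always_eventually, rule allI)
    fix k
    have "card {P. permutation_hypergraph d k P \<and> good k P} \<le> card {P. permutation_hypergraph d k P}"
      using finite_permutation_hypergraphs[of d k "\<lambda>_. True"] by (intro card_mono) auto
    then show "?ratio k \<le> 1" by (auto simp: divide_le_eq_1)
  qed
  have "(\<lambda>k. (1/4::real) ^ T k) \<longlonglongrightarrow> 0"
    using filterlim_compose[OF LIMSEQ_power_zero T_top, of "1/4::real"] by simp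
  then have "(\<lambda>k. 1 - 2 * (1/4::real) ^ T k) \<longlonglongrightarrow> 1 - 2 * 0"
    by (intro tendsto_intros)
  then have "?ratio \<longlonglongrightarrow> 1"
    using real_tendsto_sandwich[OF lower upper] by simp
  then show "(\<lambda>k. real (card {P. permutation_hypergraph d k P \<and>
              (\<forall>\<^sub>F n in sequentially.
                 real (ex_i P n) \<ge> 2 powr (c * real k powr (1/2)) * real n ^ (d - 1))})
         / real (card {P. permutation_hypergraph d k P}))
      \<longlonglongrightarrow> 1"
    unfolding good_def .
qed

end
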